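(* Let $\Omega\subset\mathbb{R}^d$ be open and bounded, let $b:\Omega\to\mathbb{R}^d$ be a vector field with $\|b\|_{L^\infty}<\infty$, and suppose that $w$ satisfies $$-\Delta w+b\cdot\nabla w=1\quad\text{in }\Omega,\qquad w=0\quad\text{on }\partial\Omega.$$ Then, with the convention that $\nabla w/|\nabla w|=0$ whenever $\nabla w=0$, the solution $u$ of $$-\Delta u-\|b\|_{L^\infty}\frac{\nabla w}{|\nabla w|}\cdot\nabla u=1\quad\text{in }\Omega,\qquad u=0\quad\text{on }\partial\Omega$$ satisfies $u\ge w$ in $\Omega$.
   Context: Vector fields are measurable, and $\|b\|_{L^\infty}$ is the essential supremum over $\Omega$ of the Euclidean norm $|b(x)|$. Solutions are understood in the usual strong sense: $u,w\in W^{2,d}_{\mathrm{loc}}(\Omega)\cap C(\overline{\Omega})$, the equation holds almost everywhere in $\Omega$, and the function vanishes on $\partial\Omega$. *)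

theory Defs
  imports "HOL-Analysis.Analysis" "HOL-Probability.Essential_Supremum"
begin

primrec C_k :: "nat \<Rightarrow> ('a::euclidean_space \<Rightarrow> real) \<Rightarrow> bool" where
  "C_k 0 f \<longleftrightarrow> continuous_on UNIV f"
| "C_k (Suc k) f \<longleftrightarrow>
     (\<forall>x. f differentiable (at x)) \<and>
     (\<forall>i\<in>Basis. C_k k (\<lambda>x. frechet_derivative f (at x) i))"

definition test_function :: "'a::euclidean_space set \<Rightarrow> ('a \<Rightarrow> real) \<Rightarrow> bool" where
  "test_function \<Omega> \<phi> \<longleftrightarrow>
     (\<forall>k. C_k k \<phi>) \<and> compact (closure {x. \<phi> x \<noteq> 0}) \<and> closure {x. \<phi> x \<noteq> 0} \<subseteq> \<Omega>"

definition Lp_loc :: "real \<Rightarrow> 'a::euclidean_space set \<Rightarrow> ('a \<Rightarrow> real) \<Rightarrow> bool" where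
  "Lp_loc p \<Omega> f \<longleftrightarrow>
     f \<in> borel_measurable (lebesgue_on \<Omega>) \<and>
     (\<forall>K. compact K \<and> K \<subseteq> \<Omega> \<longrightarrow> set_integrable lebesgue K (\<lambda>x. \<bar>f x\<bar> powr p))"

definition has_weak_partial ::
    "'a::euclidean_space set \<Rightarrow> 'a \<Rightarrow> ('a \<Rightarrow> real) \<Rightarrow> ('a \<Rightarrow> real) \<Rightarrow> bool" where
  "has_weak_partial \<Omega> i f g \<longleftrightarrow>
     Lp_loc 1 \<Omega> f \<and> Lp_loc 1 \<Omega> g \<and>
     (\<forall>\<phi>. test_function \<Omega> \<phi> \<longrightarrow>
        (LINT x|lebesgue_on \<Omega>. f x * frechet_derivative \<phi> (at x) i) =
        - (LINT x|lebesgue_on \<Omega>. g x * \<phi> x))"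

(* For open \<Omega>, weak derivatives are unique up to null sets; weak_partial selects one
   representative. It is unspecified where no weak derivative exists, so it is only
   meaningful together with has_weak_partial or W_loc. *)
definition weak_partial :: "'a::euclidean_space set \<Rightarrow> 'a \<Rightarrow> ('a \<Rightarrow> real) \<Rightarrow> 'a \<Rightarrow> real" where
  "weak_partial \<Omega> i f = (SOME g. has_weak_partial \<Omega> i f g)"

definition weak_gradient :: "'a::euclidean_space set \<Rightarrow> ('a \<Rightarrow> real) \<Rightarrow> 'a \<Rightarrow> 'a" where
  "weak_gradient \<Omega> f x = (\<Sum>i\<in>Basis. weak_partial \<Omega> i f x *\<^sub>R i)"

definition weak_laplacian :: "'a::euclidean_space set \<Rightarrow> ('a \<Rightarrow> real) \<Rightarrow> 'a \<Rightarrow> real" where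
  "weak_laplacian \<Omega> f x = (\<Sum>i\<in>Basis. weak_partial \<Omega> i (weak_partial \<Omega> i f) x)"

(* The local Sobolev space W^{k,p}_loc(\<Omega>). *)
primrec W_loc :: "nat \<Rightarrow> real \<Rightarrow> 'a::euclidean_space set \<Rightarrow> ('a \<Rightarrow> real) \<Rightarrow> bool" where
  "W_loc 0 p \<Omega> f \<longleftrightarrow> Lp_loc p \<Omega> f"
| "W_loc (Suc k) p \<Omega> f \<longleftrightarrow>
     Lp_loc p \<Omega> f \<and>
     (\<forall>i\<in>Basis. (\<exists>g. has_weak_partial \<Omega> i f g) \<and> W_loc k p \<Omega> (weak_partial \<Omega> i f))"

definition Linf_norm :: "'a::euclidean_space set \<Rightarrow> ('a \<Rightarrow> 'a) \<Rightarrow> ennreal" where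
  "Linf_norm \<Omega> b = esssup (lebesgue_on \<Omega>) (\<lambda>x. ennreal (norm (b x)))"

(* u is a strong solution of  - Laplacian u + b . grad u = f  in \<Omega>,  u = 0  on the boundary. *)
definition strong_dirichlet_solution ::
    "'a::euclidean_space set \<Rightarrow> ('a \<Rightarrow> 'a) \<Rightarrow> ('a \<Rightarrow> real) \<Rightarrow> ('a \<Rightarrow> real) \<Rightarrow> bool" where
  "strong_dirichlet_solution \<Omega> b f u \<longleftrightarrow>
     W_loc 2 (real DIM('a)) \<Omega> u \<and>
     continuous_on (closure \<Omega>) u \<and>
     (AE x in lebesgue_on \<Omega>. - weak_laplacian \<Omega> u x + b x \<bullet> weak_gradient \<Omega> u x = f x) \<and>
     (\<forall>x\<in>frontier \<Omega>. u x = 0)"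

end

theory Submission
  imports Defs "HOL-Computational_Algebra.Polynomial"
begin

text \<open>
Write \<open>B\<close> for the essential supremum of \<open>\<bar>b\<bar>\<close>. Subtracting the two equations and using
\<open>b \<bullet> \<nabla>w \<ge> - B \<bar>\<nabla>w\<bar> = - B (\<nabla>w / \<bar>\<nabla>w\<bar>) \<bullet> \<nabla>w\<close> shows that \<open>z = w - u\<close>, which is
continuous and vanishes on the boundary, satisfies \<open>\<Delta>z \<ge> - B \<bar>\<nabla>z\<bar>\<close> almost everywhere
(\<open>drift_difference_bound\<close>). The theorem is therefore a weak maximum principle, \<open>z \<le> 0\<close>
(\<open>weak_maximum_principle\<close>).

Two ideas give this maximum principle without Sobolev embeddings or the
Aleksandrov--Bakelman--Pucci estimate. First, if \<open>z\<close> is positive somewhere, adding a small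
multiple of an explicit bounded function \<open>T\<close> of one coordinate (\<open>barrier\<close>) makes the inequality
strict: \<open>\<zeta> = z + T\<close> still has its maximum inside \<open>\<Omega>\<close>, and
\<open>\<Delta>\<zeta> \<ge> \<delta> - B \<bar>\<nabla>\<zeta>\<bar>\<close> with \<open>\<delta> > 0\<close>. Secondly, test with \<open>Y\<^sup>2\<close>, where
\<open>Y = max 0 (\<zeta> - k)\<close> and \<open>k\<close> lies slightly below the maximum of \<open>\<zeta>\<close>. Integration by parts and
Young's inequality give
\<open>0 = \<integral> 2 Y \<bar>\<nabla>\<zeta>\<bar>\<^sup>2 + Y\<^sup>2 \<Delta>\<zeta> \<ge> \<integral> Y\<^sup>2 (\<delta> - B\<^sup>2 Y / 8)\<close>.
Since \<open>Y\<close> is uniformly small and positive on an open set, the right-hand side is positive, a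
contradiction.

The integration by parts needs smoothness, so \<open>z\<close> is replaced by its mollification. Convolution
with a mollifier commutes with weak derivatives, hence the differential inequality survives with
the error \<open>B (\<bar>\<nabla>z\<bar> * \<eta> - \<bar>\<nabla>z * \<eta>\<bar>)\<close> (\<open>mollified_differential_inequality\<close>). This error
tends to \<open>0\<close> in \<open>L\<^sup>1\<close> (\<open>mollify_error_L1\<close>), which suffices because it is multiplied by the bounded
function \<open>Y\<^sup>2\<close> (\<open>energy_estimate\<close>). So continuity of \<open>z\<close> and local integrability of its weak
derivatives up to the second order suffice, in every dimension.
\<close>

section \<open>Smooth functions\<close>

lemma C_k_Suc_imp: "C_k (Suc k) f \<Longrightarrow> C_k k f"
proof (induction k arbitrary: f)
  case 0
  then show ?case
    by (auto simp: continuous_on_eq_continuous_at intro: differentiable_imp_continuous_within)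
next
  case (Suc k)
  then show ?case by simp
qed

lemma frechet_derivative_eq:
  "(f has_derivative f') (at x) \<Longrightarrow> frechet_derivative f (at x) i = f' i"
  using frechet_derivative_at by metis

lemma C_k_SucI:
  assumes "\<And>x. (f has_derivative f' x) (at x)"
    and "\<And>i. i \<in> Basis \<Longrightarrow> C_k k (\<lambda>x. f' x i)"
  shows "C_k (Suc k) f"
proof -
  have "(\<lambda>x. frechet_derivative f (at x) i) = (\<lambda>x. f' x i)" for i
    using frechet_derivative_eq[OF assms(1)] by blast
  moreover have "f differentiable (at x)" for x
    using assms(1) differentiableI by blast
  ultimately show ?thesis
    using assms(2) by simp
qed

lemma C_k_Suc_has_derivative:
  "C_k (Suc k) f \<Longrightarrow> (f has_derivative frechet_derivative f (at x)) (at x)"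
  by (simp add: frechet_derivative_works)

lemma C_k_const: "C_k k (\<lambda>x. c)"
proof (induction k arbitrary: c)
  case 0
  then show ?case by simp
next
  case (Suc k)
  show ?case
    by (rule C_k_SucI[where f' = "\<lambda>x i. 0"]) (use Suc in auto)
qed

lemma C_k_add: "C_k k f \<Longrightarrow> C_k k g \<Longrightarrow> C_k k (\<lambda>x. f x + g x)"
proof (induction k arbitrary: f g)
  case 0
  then show ?case by (simp add: continuous_on_add)
next
  case (Suc k)
  show ?case
    by (rule C_k_SucI[OF has_derivative_add[OF C_k_Suc_has_derivative C_k_Suc_has_derivative]])
      (use Suc in auto)
qed

lemma C_k_mult: "C_k k f \<Longrightarrow> C_k k g \<Longrightarrow> C_k k (\<lambda>x. f x * g x)"
proof (induction k arbitrary: f g)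
  case 0
  then show ?case by (simp add: continuous_on_mult)
next
  case (Suc k)
  have fg: "C_k k f" "C_k k g"
    using Suc.prems by (blast intro: C_k_Suc_imp)+
  show ?case
  proof (rule C_k_SucI)
    fix x
    show "((\<lambda>x. f x * g x) has_derivative
        (\<lambda>h. f x * frechet_derivative g (at x) h + frechet_derivative f (at x) h * g x)) (at x)"
      by (rule has_derivative_mult) (use Suc.prems C_k_Suc_has_derivative in blast)+
  next
    fix i :: 'a assume "i \<in> Basis"
    then have "C_k k (\<lambda>x. frechet_derivative f (at x) i)" "C_k k (\<lambda>x. frechet_derivative g (at x) i)"
      using Suc.prems by simp_all
    then show "C_k k (\<lambda>x. f x * frechet_derivative g (at x) i + frechet_derivative f (at x) i * g x)"
      by (intro C_k_add Suc.IH fg)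
  qed
qed

lemma C_k_inner: "C_k k (\<lambda>x. x \<bullet> a)"
proof (cases k)
  case 0
  then show ?thesis by (auto intro: continuous_intros)
next
  case (Suc k)
  show ?thesis unfolding Suc
    by (rule C_k_SucI[where f' = "\<lambda>x i. i \<bullet> a"]) (auto intro!: derivative_eq_intros C_k_const)
qed

lemma C_k_reflect: "C_k k f \<Longrightarrow> C_k k (\<lambda>y. f (x - y))"
proof (induction k arbitrary: f)
  case 0
  have "continuous_on UNIV (\<lambda>y. f (x - y))"
    by (rule continuous_on_compose2[where s = UNIV and t = UNIV, of f])
      (use 0 in \<open>auto intro: continuous_intros\<close>)
  then show ?case by simp
next
  case (Suc k)
  show ?case
  proof (rule C_k_SucI)
    fix y
    have "((\<lambda>y. x - y) has_derivative (\<lambda>h. - h)) (at y)"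
      by (auto intro!: derivative_eq_intros)
    from has_derivative_compose[OF this C_k_Suc_has_derivative[OF Suc.prems]]
    show "((\<lambda>y. f (x - y)) has_derivative
        (\<lambda>h. frechet_derivative f (at (x - y)) (- h))) (at y)" .
  next
    fix i :: 'a assume i: "i \<in> Basis"
    have "linear (frechet_derivative f (at y))" for y
      using C_k_Suc_has_derivative[OF Suc.prems] has_derivative_linear by blast
    then have "frechet_derivative f (at (x - y)) (- i) = (-1) * frechet_derivative f (at (x - y)) i" for y
      by (simp add: linear_neg)
    moreover have "C_k k (\<lambda>y. (-1) * frechet_derivative f (at (x - y)) i)"
      using Suc i by (intro C_k_mult C_k_const) auto
    ultimately show "C_k k (\<lambda>y. frechet_derivative f (at (x - y)) (- i))"
      by simp
  qed
qed

text \<open>The family \<open>p(1/t) exp(-1/t)\<close>, extended by \<open>0\<close> to \<open>t \<le> 0\<close>, for polynomials \<open>p\<close>: it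
contains the standard flat function (\<open>p = 1\<close>) and is closed under differentiation, so one
induction over the order of differentiability shows that all its members are smooth.\<close>

definition flat_exp :: "real poly \<Rightarrow> real \<Rightarrow> real" where
  "flat_exp p t = (if t > 0 then poly p (1 / t) * exp (- (1 / t)) else 0)"

lemma poly_times_exp_minus_tendsto_0: "((\<lambda>x::real. poly p x * exp (- x)) \<longlongrightarrow> 0) at_top"
proof -
  have "((\<lambda>x::real. \<Sum>k\<le>degree p. coeff p k * (x ^ k / exp x)) \<longlongrightarrow> (\<Sum>k\<le>degree p. coeff p k * 0)) at_top"
    by (intro tendsto_intros tendsto_power_div_exp_0)
  then show ?thesis
    by (simp add: poly_altdef sum_distrib_right exp_minus divide_inverse mult.assoc)
qed

lemma flat_exp_has_derivative:
  "(flat_exp p has_real_derivative flat_exp (monom 1 2 * (p - pderiv p)) t) (at t)"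
proof -
  consider "t > 0" | "t < 0" | "t = 0" by linarith
  then show ?thesis
  proof cases
    case 1
    have "((\<lambda>t. poly p (1 / t) * exp (- (1 / t))) has_real_derivative
        flat_exp (monom 1 2 * (p - pderiv p)) t) (at t)"
      using 1
      by (auto intro!: derivative_eq_intros DERIV_chain2[OF poly_DERIV]
          simp: flat_exp_def poly_monom field_simps power2_eq_square)
    moreover have "\<forall>\<^sub>F s in nhds t. flat_exp p s = poly p (1 / s) * exp (- (1 / s))"
      using eventually_nhds_in_open[of "{0<..}" t] 1
      by (auto elim!: eventually_mono simp: flat_exp_def)
    ultimately show ?thesis
      by (subst DERIV_cong_ev[OF refl _ refl]) auto
  next
    case 2
    have "\<forall>\<^sub>F s in nhds t. flat_exp p s = 0"
      using eventually_nhds_in_open[of "{..<0}" t] 2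
      by (auto elim!: eventually_mono simp: flat_exp_def)
    then show ?thesis
      using 2 by (subst DERIV_cong_ev[OF refl _ refl]) (auto simp: flat_exp_def)
  next
    case 3
    have "((\<lambda>h. poly (monom 1 1 * p) (inverse h) * exp (- inverse h)) \<longlongrightarrow> 0) (at_right 0)"
      using poly_times_exp_minus_tendsto_0 filterlim_inverse_at_top_right
      by (rule filterlim_compose)
    then have "((\<lambda>h. flat_exp p h / h) \<longlongrightarrow> 0) (at_right 0)"
      by (rule Lim_transform_eventually)
        (auto simp: flat_exp_def poly_monom field_simps eventually_at_right_less
          intro!: eventually_mono[OF eventually_at_right_less])
    moreover have "((\<lambda>h. flat_exp p h / h) \<longlongrightarrow> 0) (at_left 0)"
      by (rule Lim_transform_eventually[OF tendsto_const])
        (auto simp: flat_exp_def intro!: eventually_at_leftI[of "-1"])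
    ultimately have "((\<lambda>h. flat_exp p h / h) \<longlongrightarrow> 0) (at 0)"
      by (simp add: filterlim_split_at)
    then show ?thesis
      using 3 by (simp add: DERIV_def flat_exp_def)
  qed
qed

lemma C_k_radial_flat_exp: "C_k k (\<lambda>x. flat_exp p (r - x \<bullet> x))"
proof (induction k arbitrary: p)
  case 0
  have "continuous_on UNIV (flat_exp p)"
    using flat_exp_has_derivative DERIV_continuous_on by (metis has_field_derivative_at_within)
  then have "continuous_on UNIV (\<lambda>x. flat_exp p (r - x \<bullet> x))"
    by (rule continuous_on_compose2) (auto intro!: continuous_on_diff continuous_on_inner continuous_on_const continuous_on_id)
  then show ?case by simp
next
  case (Suc k)
  let ?q = "monom 1 2 * (p - pderiv p)"
  show ?case
  proof (rule C_k_SucI)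
    fix x :: 'a
    have "((\<lambda>x. r - x \<bullet> x) has_derivative (\<lambda>i. - 2 * (x \<bullet> i))) (at x)"
      by (auto intro!: derivative_eq_intros simp: inner_commute)
    from has_derivative_compose[OF this flat_exp_has_derivative[unfolded has_field_derivative_def]]
    show "((\<lambda>x. flat_exp p (r - x \<bullet> x)) has_derivative
        (\<lambda>i. flat_exp ?q (r - x \<bullet> x) * (- 2 * (x \<bullet> i)))) (at x)" .
    show "C_k k (\<lambda>x. flat_exp ?q (r - x \<bullet> x) * (- 2 * (x \<bullet> i)))" for i :: 'a
      by (intro C_k_mult C_k_const C_k_inner Suc)
  qed
qed

abbreviation partial :: "'a::euclidean_space \<Rightarrow> ('a \<Rightarrow> real) \<Rightarrow> 'a \<Rightarrow> real" where
  "partial i f \<equiv> \<lambda>x. frechet_derivative f (at x) i"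

lemma partial_vanishes:
  assumes "open U" "\<And>x. x \<in> U \<Longrightarrow> f x = 0" "x \<in> U"
  shows "partial i f x = 0"
proof -
  have "(f has_derivative (\<lambda>_. 0)) (at x)"
    by (rule has_derivative_transform_within_open[OF has_derivative_const assms(1,3)])
      (use assms(2) in auto)
  then show ?thesis by (rule frechet_derivative_eq)
qed

lemma partial_zero_outside:
  assumes "\<And>y::'a::euclidean_space. \<rho> < norm y \<Longrightarrow> \<psi> y = 0" "\<rho> < norm y"
  shows "partial i \<psi> y = 0"
proof (rule partial_vanishes[where U = "- cball 0 \<rho>"])
  show "open (- cball (0::'a) \<rho>)" by (simp add: open_Compl)
qed (use assms in auto)

section \<open>Partial derivatives and integration by parts\<close>

text \<open>Only derivatives along a line are needed for the convolution and divergence arguments, and they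
pass to convolutions by one-dimensional dominated convergence.\<close>

definition has_partial :: "('a::euclidean_space \<Rightarrow> real) \<Rightarrow> 'a \<Rightarrow> ('a \<Rightarrow> real) \<Rightarrow> bool" where
  "has_partial f i f' \<longleftrightarrow> (\<forall>x. ((\<lambda>t. f (x + t *\<^sub>R i)) has_real_derivative f' x) (at 0))"

lemma has_partial_along_line:
  assumes "has_partial f i f'"
  shows "((\<lambda>t. f (x + t *\<^sub>R i)) has_real_derivative f' (x + s *\<^sub>R i)) (at s)"
proof -
  have "((\<lambda>t. f (x + s *\<^sub>R i + t *\<^sub>R i)) has_real_derivative f' (x + s *\<^sub>R i)) (at 0)"
    using assms by (simp add: has_partial_def)
  then have "((\<lambda>t. f (x + (t + s) *\<^sub>R i)) has_real_derivative f' (x + s *\<^sub>R i)) (at 0)"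
    by (simp add: algebra_simps)
  then show ?thesis
    using DERIV_shift[of "\<lambda>t. f (x + t *\<^sub>R i)" "f' (x + s *\<^sub>R i)" 0 s] by simp
qed

lemma has_partial_lipschitz:
  assumes "has_partial f i f'" and "\<And>x. \<bar>f' x\<bar> \<le> C"
  shows "\<bar>f (x + s *\<^sub>R i) - f x\<bar> \<le> C * \<bar>s\<bar>"
proof -
  have "norm (f (x + s *\<^sub>R i) - f (x + 0 *\<^sub>R i)) \<le> C * norm (s - 0)"
    by (rule field_differentiable_bound[where S = UNIV and f = "\<lambda>t. f (x + t *\<^sub>R i)"
          and f' = "\<lambda>t. f' (x + t *\<^sub>R i)"])
      (use assms has_partial_along_line in auto)
  then show ?thesis by simp
qed

lemma C_k_has_partial:
  "C_k (Suc k) f \<Longrightarrow> has_partial f i (\<lambda>x. frechet_derivative f (at x) i)"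
  unfolding has_partial_def
proof
  fix x assume f: "C_k (Suc k) f"
  have l: "((\<lambda>t::real. x + t *\<^sub>R i) has_derivative (\<lambda>t. t *\<^sub>R i)) (at 0)"
    by (auto intro!: derivative_eq_intros)
  have d: "(f has_derivative frechet_derivative f (at x)) (at (x + 0 *\<^sub>R i))"
    using C_k_Suc_has_derivative[OF f] by simp
  have "linear (frechet_derivative f (at x))"
    using C_k_Suc_has_derivative[OF f] has_derivative_linear by blast
  then have "frechet_derivative f (at x) (t *\<^sub>R i) = frechet_derivative f (at x) i * t" for t
    by (simp add: linear_cmul)
  with has_derivative_compose[OF l d]
  show "((\<lambda>t. f (x + t *\<^sub>R i)) has_real_derivative frechet_derivative f (at x) i) (at 0)"
    by (simp add: has_field_derivative_def)
qed

lemma bounded_of_compact_support: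
  fixes f :: "'a::euclidean_space \<Rightarrow> real"
  assumes "continuous_on UNIV f" "compact K" "\<And>x. x \<notin> K \<Longrightarrow> f x = 0"
  obtains C where "C > 0" "\<And>x. \<bar>f x\<bar> \<le> C"
proof -
  have "compact (f ` K)"
    using assms(1,2) continuous_on_subset[OF _ subset_UNIV] by (intro compact_continuous_image)
  then obtain C where C: "C > 0" "\<And>x. x \<in> K \<Longrightarrow> \<bar>f x\<bar> \<le> C"
    using compact_imp_bounded bounded_pos by (metis imageI real_norm_def)
  then show thesis
    using that[of C] assms(3) by (metis abs_zero less_imp_le)
qed

lemma integrable_of_compact_support:
  fixes f :: "'a::euclidean_space \<Rightarrow> real"
  assumes "continuous_on UNIV f" "compact K" "\<And>x. x \<notin> K \<Longrightarrow> f x = 0"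
  shows "integrable lborel f"
proof -
  have "integrable lborel (\<lambda>x. indicator K x *\<^sub>R f x)"
    using assms(1,2) by (intro borel_integrable_compact) (auto intro: continuous_on_subset)
  also have "(\<lambda>x. indicator K x *\<^sub>R f x) = f"
    using assms(3) by (fastforce simp: indicator_def)
  finally show ?thesis .
qed

lemma lborel_eq_distr_plus: "(lborel :: 'a::euclidean_space measure) = distr lborel borel ((+) a)"
  using lborel_affine[of 1 a] by (simp add: density_1)

lemma lborel_eq_distr_reflect:
  "(lborel :: 'a::euclidean_space measure) = distr lborel borel (\<lambda>y. a - y)"
  using lborel_affine[of "-1" a] by (simp add: density_1)

lemma nn_integral_translate:
  fixes f :: "'a::euclidean_space \<Rightarrow> ennreal"
  assumes [measurable]: "f \<in> borel_measurable borel"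
  shows "(\<integral>\<^sup>+x. f (x - z) \<partial>lborel) = (\<integral>\<^sup>+x. f x \<partial>lborel)"
proof -
  have "(\<integral>\<^sup>+x. f x \<partial>lborel) = (\<integral>\<^sup>+x. f x \<partial>distr lborel borel ((+) (- z)))"
    using lborel_eq_distr_plus[of "- z"] by simp
  also have "\<dots> = (\<integral>\<^sup>+x. f (x - z) \<partial>lborel)"
    by (subst nn_integral_distr) auto
  finally show ?thesis ..
qed

lemma
  fixes f :: "'a::euclidean_space \<Rightarrow> real"
  assumes "f \<in> borel_measurable borel"
  shows integrable_translate: "integrable lborel f \<Longrightarrow> integrable lborel (\<lambda>x. f (x + z))"
    and integral_translate: "(\<integral>x. f (x + z) \<partial>lborel) = (\<integral>x. f x \<partial>lborel)"
proof -
  have eq: "(lborel :: 'a measure) = distr lborel borel (\<lambda>x. x + z)"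
    using lborel_eq_distr_plus[of z] by (simp add: add.commute cong: distr_cong)
  show "(\<integral>x. f (x + z) \<partial>lborel) = (\<integral>x. f x \<partial>lborel)"
    by (subst (2) eq, subst integral_distr) (use assms in auto)
  show "integrable lborel (\<lambda>x. f (x + z))" if "integrable lborel f"
    using that by (subst (asm) eq, subst (asm) integrable_distr_eq) (use assms in auto)
qed

lemma
  fixes f :: "'a::euclidean_space \<Rightarrow> real"
  assumes "f \<in> borel_measurable borel"
  shows integrable_reflect_lborel: "integrable lborel (\<lambda>y. f (x - y)) \<longleftrightarrow> integrable lborel f"
    and integral_reflect_lborel: "(\<integral>y. f (x - y) \<partial>lborel) = (\<integral>y. f y \<partial>lborel)"
proof -
  note eq = lborel_eq_distr_reflect[of x]
  show "(\<integral>y. f (x - y) \<partial>lborel) = (\<integral>y. f y \<partial>lborel)"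
    by (subst (2) eq, subst integral_distr) (use assms in auto)
  show "integrable lborel (\<lambda>y. f (x - y)) \<longleftrightarrow> integrable lborel f"
    by (subst (2) eq, subst integrable_distr_eq) (use assms in auto)
qed

text \<open>The integral of a difference quotient of \<open>f\<close> vanishes by translation invariance, and the quotients
converge dominatedly to the derivative. This replaces the usual iterated integration.\<close>

lemma integral_partial_eq_0:
  fixes f f' :: "'a::euclidean_space \<Rightarrow> real"
  assumes part: "has_partial f i f'"
    and cont: "continuous_on UNIV f" "continuous_on UNIV f'"
    and K: "compact K" "\<And>x. x \<notin> K \<Longrightarrow> f x = 0" "\<And>x. x \<notin> K \<Longrightarrow> f' x = 0"
  shows "(\<integral>x. f' x \<partial>lborel) = 0"
proof -
  obtain C where C: "C > 0" "\<And>x. \<bar>f' x\<bar> \<le> C"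
    using bounded_of_compact_support[OF cont(2) K(1,3)] by blast
  obtain R where R: "\<And>x. x \<in> K \<Longrightarrow> norm x \<le> R"
    using K(1) compact_imp_bounded bounded_iff by metis
  define q where "q n x = (f (x + (1 / real (Suc n)) *\<^sub>R i) - f x) / (1 / real (Suc n))" for n x
  have [measurable]: "f \<in> borel_measurable borel" "f' \<in> borel_measurable borel"
    using cont by (auto intro: borel_measurable_continuous_onI)
  have int: "integrable lborel f"
    by (rule integrable_of_compact_support[OF cont(1) K(1,2)])
  have "(\<integral>x. q n x \<partial>lborel) = 0" for n
    unfolding q_def using int
    by (simp add: integrable_translate integral_translate)
  moreover have "(\<lambda>n. \<integral>x. q n x \<partial>lborel) \<longlonglongrightarrow> (\<integral>x. f' x \<partial>lborel)"
  proof (rule integral_dominated_convergence[where w = "\<lambda>x. C * indicator (cball 0 (R + norm i)) x"])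
    show "f' \<in> borel_measurable lborel" "\<And>n. q n \<in> borel_measurable lborel"
      unfolding q_def by measurable
    show "integrable lborel (\<lambda>x::'a. C * indicator (cball 0 (R + norm i)) x)"
      using emeasure_bounded_finite[OF bounded_cball, of "0::'a" "R + norm i"]
      by (intro integrable_mult_right integrable_real_indicator) simp_all
    show "AE x in lborel. (\<lambda>n. q n x) \<longlonglongrightarrow> f' x"
    proof (rule AE_I2)
      fix x
      have "((\<lambda>h. (f (x + h *\<^sub>R i) - f x) / h) \<longlongrightarrow> f' x) (at 0)"
        using part by (simp add: has_partial_def DERIV_def)
      moreover have "filterlim (\<lambda>n. 1 / real (Suc n)) (at 0) sequentially"
        using LIMSEQ_inverse_real_of_nat by (simp add: filterlim_at inverse_eq_divide)
      ultimately show "(\<lambda>n. q n x) \<longlonglongrightarrow> f' x"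
        unfolding q_def by (rule filterlim_compose)
    qed
    show "AE x in lborel. norm (q n x) \<le> C * indicator (cball 0 (R + norm i)) x" for n
    proof (rule AE_I2)
      fix x
      let ?s = "1 / real (Suc n)"
      have s: "0 < ?s" "?s \<le> 1" by (auto simp: divide_simps)
      show "norm (q n x) \<le> C * indicator (cball 0 (R + norm i)) x"
      proof (cases "norm x \<le> R + norm i")
        case True
        have "\<bar>f (x + ?s *\<^sub>R i) - f x\<bar> \<le> C * \<bar>?s\<bar>"
          by (rule has_partial_lipschitz[OF part C(2)])
        then have "\<bar>f (x + ?s *\<^sub>R i) - f x\<bar> / \<bar>?s\<bar> \<le> C"
          using s by (subst pos_divide_le_eq) auto
        then show ?thesis
          using True s(1) by (simp only: q_def real_norm_def abs_divide) simp
      next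
        case False
        have "norm (?s *\<^sub>R i) \<le> norm i"
          using mult_right_mono[OF s(2), of "norm i"] s(1) by simp
        then have "norm (x + ?s *\<^sub>R i) > R"
          using False norm_diff_ineq[of x "?s *\<^sub>R i"] by linarith
        moreover have "norm x > R"
          using False norm_ge_zero[of i] by linarith
        ultimately have "f (x + ?s *\<^sub>R i) = 0" "f x = 0"
          using K(2) R by (meson not_le)+
        then show ?thesis using C(1) by (simp add: q_def)
      qed
    qed
  qed
  ultimately show ?thesis
    by (simp add: LIMSEQ_const_iff)
qed

lemma bounded_of_ball_support:
  fixes f :: "'a::euclidean_space \<Rightarrow> real"
  assumes "continuous_on UNIV f" "\<And>y. \<rho> < norm y \<Longrightarrow> f y = 0"
  obtains C where "\<And>x. \<bar>f x\<bar> \<le> C"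
  by (rule bounded_of_compact_support[of f "cball 0 \<rho>"]) (use assms in auto)

lemma has_partial_add:
  "has_partial f i f' \<Longrightarrow> has_partial g i g' \<Longrightarrow> has_partial (\<lambda>x. f x + g x) i (\<lambda>x. f' x + g' x)"
  by (auto simp: has_partial_def intro: DERIV_add)

lemma has_partial_mult:
  "has_partial f i f' \<Longrightarrow> has_partial g i g' \<Longrightarrow>
    has_partial (\<lambda>x. f x * g x) i (\<lambda>x. f' x * g x + f x * g' x)"
  unfolding has_partial_def
  by (auto intro!: derivative_eq_intros)

lemma has_partial_compose:
  assumes "has_partial f i f'" "\<And>t. (g has_real_derivative g' t) (at t)"
  shows "has_partial (\<lambda>x. g (f x)) i (\<lambda>x. g' (f x) * f' x)"
  unfolding has_partial_def
proof
  fix x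
  show "((\<lambda>t. g (f (x + t *\<^sub>R i))) has_real_derivative g' (f x) * f' x) (at 0)"
    using DERIV_chain2[of g "g' (f x)" "\<lambda>t. f (x + t *\<^sub>R i)" 0 "f' x" UNIV] assms
    by (simp add: has_partial_def)
qed

lemma has_partial_inner: "has_partial (\<lambda>x. x \<bullet> a) i (\<lambda>x. i \<bullet> a)"
  by (auto simp: has_partial_def inner_left_distrib intro!: derivative_eq_intros)

lemma has_partial_const: "has_partial (\<lambda>x. c) i (\<lambda>x. 0)"
  by (simp add: has_partial_def)

text \<open>The square makes the positive part continuously differentiable, so that it may be used in the
classical integration by parts.\<close>

lemma DERIV_positive_part_square:
  "((\<lambda>t::real. (max 0 t)\<^sup>2) has_real_derivative 2 * max 0 t) (at t)"
proof -
  consider "t > 0" | "t < 0" | "t = 0" by linarith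
  then show ?thesis
  proof cases
    case 1
    have "((\<lambda>t::real. t\<^sup>2) has_real_derivative 2 * max 0 t) (at t)"
      using 1 by (auto intro!: derivative_eq_intros)
    then show ?thesis
      by (rule has_field_derivative_transform_within_open[where S = "{0<..}"]) (use 1 in auto)
  next
    case 2
    have "((\<lambda>t::real. 0) has_real_derivative 2 * max 0 t) (at t)"
      using 2 by auto
    then show ?thesis
      by (rule has_field_derivative_transform_within_open[where S = "{..<0}"]) (use 2 in auto)
  next
    case 3
    have "((\<lambda>h::real. max 0 h) \<longlongrightarrow> max 0 0) (at 0)"
      by (intro tendsto_intros)
    moreover have "max 0 h = (max 0 h)\<^sup>2 / h" for h :: real
      by (cases "h = 0") (auto simp: max_def power2_eq_square)
    ultimately have "((\<lambda>h::real. (max 0 h)\<^sup>2 / h) \<longlongrightarrow> 0) (at 0)"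
      by simp
    then show ?thesis
      using 3 by (simp add: DERIV_def)
  qed
qed

section \<open>Mollifiers and mollification\<close>

text \<open>The radius \<open>\<rho>\<close> is a bound for the support, so a mollifier of radius \<open>\<rho>\<close> is one of every larger radius
as well.\<close>

definition mollifier :: "real \<Rightarrow> ('a::euclidean_space \<Rightarrow> real) \<Rightarrow> bool" where
  "mollifier \<rho> \<eta> \<longleftrightarrow> (\<forall>k. C_k k \<eta>) \<and> (\<forall>x. \<eta> x \<ge> 0) \<and> (\<forall>x. \<rho> \<le> norm x \<longrightarrow> \<eta> x = 0)
    \<and> (\<integral>x. \<eta> x \<partial>lborel) = 1"

lemma ex_mollifier:
  fixes \<rho> :: real assumes "\<rho> > 0"
  obtains \<eta> :: "'a::euclidean_space \<Rightarrow> real" where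
    "mollifier \<rho> \<eta>"
proof -
  define f :: "'a \<Rightarrow> real" where "f x = flat_exp 1 (\<rho>\<^sup>2 - x \<bullet> x)" for x
  have smooth: "C_k k f" for k
    unfolding f_def[abs_def] by (rule C_k_radial_flat_exp)
  have cont: "continuous_on UNIV f"
    using smooth[of 0] by simp
  have nonneg: "f x \<ge> 0" for x
    by (simp add: f_def flat_exp_def)
  have supp: "f x = 0" if "\<rho> \<le> norm x" for x
  proof -
    have "\<rho>\<^sup>2 \<le> x \<bullet> x"
      using that assms by (simp add: power2_norm_eq_inner[symmetric])
    then show ?thesis by (simp add: f_def flat_exp_def)
  qed
  have int: "integrable lborel f"
    by (rule integrable_of_compact_support[OF cont compact_cball[of 0 \<rho>]]) (use supp in auto)
  have pos: "(\<integral>x. f x \<partial>lborel) > 0"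
  proof -
    have "(\<integral>x. f x \<partial>lborel) \<noteq> 0"
    proof
      assume "(\<integral>x. f x \<partial>lborel) = 0"
      then have ae: "AE x in lborel. f x = 0"
        using integral_nonneg_eq_0_iff_AE[OF int] nonneg by simp
      have "f x \<noteq> 0" if "x \<in> ball 0 \<rho>" for x
      proof -
        have "x \<bullet> x < \<rho>\<^sup>2"
          using that by (simp add: power2_norm_eq_inner[symmetric] power_strict_mono)
        then show ?thesis
          by (simp add: f_def flat_exp_def)
      qed
      then have "AE x in lborel. x \<notin> ball (0::'a) \<rho>"
        by (intro eventually_mono[OF ae]) blast
      then have "emeasure lborel (ball (0::'a) \<rho>) = 0"
        by (subst (asm) AE_iff_measurable[where N = "ball 0 \<rho>"]) auto
      then show False
        using content_ball_pos[OF assms, of "0::'a"] by (simp add: measure_def)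
    qed
    then show ?thesis
      using Bochner_Integration.integral_nonneg[of lborel f] nonneg by (simp add: order_less_le)
  qed
  let ?c = "inverse (\<integral>x. f x \<partial>lborel)"
  have "C_k k (\<lambda>x. ?c * f x)" for k
    by (intro C_k_mult C_k_const smooth)
  then have "mollifier \<rho> (\<lambda>x. ?c * f x)"
    using nonneg pos supp by (simp add: mollifier_def)
  then show thesis by (rule that)
qed

lemma
  assumes "mollifier \<rho> \<eta>"
  shows mollifier_smooth: "C_k k \<eta>"
    and mollifier_nonneg: "\<eta> x \<ge> 0"
    and mollifier_zero: "\<rho> \<le> norm x \<Longrightarrow> \<eta> x = 0"
    and mollifier_integral: "(\<integral>x. \<eta> x \<partial>lborel) = 1"
    and mollifier_continuous: "continuous_on UNIV \<eta>"
    and mollifier_integrable: "integrable lborel \<eta>"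
proof -
  show *: "C_k k \<eta>" "\<eta> x \<ge> 0" "\<rho> \<le> norm x \<Longrightarrow> \<eta> x = 0" "(\<integral>x. \<eta> x \<partial>lborel) = 1" for k x
    using assms by (auto simp: mollifier_def)
  show c: "continuous_on UNIV \<eta>"
    using *(1)[of 0] by simp
  show "integrable lborel \<eta>"
    using *(4) not_integrable_integral_eq by fastforce
qed

lemma mollifier_bounded:
  fixes \<eta> :: "'a::euclidean_space \<Rightarrow> real"
  assumes "mollifier \<rho> \<eta>" obtains C where "C > 0" "\<And>x. \<bar>\<eta> x\<bar> \<le> C"
  by (rule bounded_of_compact_support[OF mollifier_continuous[OF assms] compact_cball[of 0 \<rho>]])
    (use mollifier_zero[OF assms] in auto)

lemma mollifier_reflected:
  fixes \<eta> :: "'a::euclidean_space \<Rightarrow> real"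
  assumes "mollifier \<rho> \<eta>"
  shows "integrable lborel (\<lambda>y. \<eta> (x - y))" "(\<integral>y. \<eta> (x - y) \<partial>lborel) = 1"
proof -
  have [measurable]: "\<eta> \<in> borel_measurable borel"
    using mollifier_continuous[OF assms] by (rule borel_measurable_continuous_onI)
  show "integrable lborel (\<lambda>y. \<eta> (x - y))" "(\<integral>y. \<eta> (x - y) \<partial>lborel) = 1"
    using mollifier_integrable[OF assms] mollifier_integral[OF assms]
    by (simp_all add: integrable_reflect_lborel integral_reflect_lborel)
qed

definition mollify :: "('a::euclidean_space \<Rightarrow> real) \<Rightarrow> ('a \<Rightarrow> real) \<Rightarrow> 'a \<Rightarrow> real" where
  "mollify F \<psi> x = (\<integral>y. F y * \<psi> (x - y) \<partial>lborel)"

lemma mollify_integrable: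
  fixes F :: "'a::euclidean_space \<Rightarrow> real"
  assumes F: "integrable lborel F" and \<psi>: "continuous_on UNIV \<psi>" "\<And>x. \<bar>\<psi> x\<bar> \<le> C"
  shows "integrable lborel (\<lambda>y. F y * \<psi> (x - y))"
proof (rule Bochner_Integration.integrable_bound)
  have [measurable]: "\<psi> \<in> borel_measurable borel"
    using \<psi>(1) by (rule borel_measurable_continuous_onI)
  show "(\<lambda>y. F y * \<psi> (x - y)) \<in> borel_measurable lborel"
    using F by measurable
  show "integrable lborel (\<lambda>y. C * F y)"
    using F by simp
  show "AE y in lborel. norm (F y * \<psi> (x - y)) \<le> norm (C * F y)"
    using order_trans[OF \<psi>(2) abs_ge_self]
    by (intro AE_I2) (auto simp: abs_mult mult.commute[of "\<bar>F _\<bar>"] intro!: mult_right_mono)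
qed

lemma continuous_on_mollify:
  fixes F :: "'a::euclidean_space \<Rightarrow> real"
  assumes F: "integrable lborel F" and \<psi>: "continuous_on UNIV \<psi>" "\<And>x. \<bar>\<psi> x\<bar> \<le> C"
  shows "continuous_on UNIV (mollify F \<psi>)"
proof (unfold continuous_on_sequentially, safe)
  fix x :: "nat \<Rightarrow> 'a" and a assume x: "x \<longlonglongrightarrow> a"
  have [measurable]: "\<psi> \<in> borel_measurable borel"
    using \<psi>(1) by (rule borel_measurable_continuous_onI)
  have "(\<lambda>n. \<integral>y. F y * \<psi> (x n - y) \<partial>lborel) \<longlonglongrightarrow> (\<integral>y. F y * \<psi> (a - y) \<partial>lborel)"
  proof (rule integral_dominated_convergence[where w = "\<lambda>y. C * \<bar>F y\<bar>"])
    show "(\<lambda>y. F y * \<psi> (a - y)) \<in> borel_measurable lborel"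
      "\<And>n. (\<lambda>y. F y * \<psi> (x n - y)) \<in> borel_measurable lborel"
      using F by measurable
    show "integrable lborel (\<lambda>y. C * \<bar>F y\<bar>)"
      using F by simp
    have "(\<lambda>n. \<psi> (x n - y)) \<longlonglongrightarrow> \<psi> (a - y)" for y
      by (rule continuous_on_tendsto_compose[OF \<psi>(1)]) (auto intro!: tendsto_intros x)
    then show "AE y in lborel. (\<lambda>n. F y * \<psi> (x n - y)) \<longlonglongrightarrow> F y * \<psi> (a - y)"
      by (intro AE_I2 tendsto_mult tendsto_const)
    show "AE y in lborel. norm (F y * \<psi> (x n - y)) \<le> C * \<bar>F y\<bar>" for n
      using \<psi>(2) by (auto simp: abs_mult mult.commute[of "\<bar>F _\<bar>"] intro!: mult_right_mono)
  qed
  then show "(mollify F \<psi> \<circ> x) \<longlonglongrightarrow> mollify F \<psi> a"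
    by (simp add: mollify_def o_def)
qed

text \<open>The derivative always falls on the kernel; \<open>F\<close> itself is only integrable.\<close>

lemma has_partial_mollify:
  fixes F :: "'a::euclidean_space \<Rightarrow> real"
  assumes F: "integrable lborel F" and part: "has_partial \<psi> i \<psi>'"
    and cont: "continuous_on UNIV \<psi>" "continuous_on UNIV \<psi>'"
    and bd: "\<And>x. \<bar>\<psi> x\<bar> \<le> C" "\<And>x. \<bar>\<psi>' x\<bar> \<le> C'"
  shows "has_partial (mollify F \<psi>) i (mollify F \<psi>')"
  unfolding has_partial_def DERIV_def
proof (rule allI, rule tendsto_at_iff_sequentially[THEN iffD2], intro allI impI)
  fix x and h :: "nat \<Rightarrow> real"
  assume h0: "\<forall>n. h n \<in> UNIV - {0}" and h: "h \<longlonglongrightarrow> 0"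
  have [measurable]: "\<psi> \<in> borel_measurable borel" "\<psi>' \<in> borel_measurable borel"
    using cont by (auto intro: borel_measurable_continuous_onI)
  let ?q = "\<lambda>n y. (\<psi> (x - y + h n *\<^sub>R i) - \<psi> (x - y)) / h n"
  have "(\<lambda>n. \<integral>y. F y * ?q n y \<partial>lborel) \<longlonglongrightarrow> (\<integral>y. F y * \<psi>' (x - y) \<partial>lborel)"
  proof (rule integral_dominated_convergence[where w = "\<lambda>y. C' * \<bar>F y\<bar>"])
    show "(\<lambda>y. F y * \<psi>' (x - y)) \<in> borel_measurable lborel"
      "\<And>n. (\<lambda>y. F y * ?q n y) \<in> borel_measurable lborel"
      using F by measurable
    show "integrable lborel (\<lambda>y. C' * \<bar>F y\<bar>)"
      using F by simp
    have "(\<lambda>n. ?q n y) \<longlonglongrightarrow> \<psi>' (x - y)" for y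
    proof -
      have "((\<lambda>h. (\<psi> (x - y + h *\<^sub>R i) - \<psi> (x - y)) / h) \<longlongrightarrow> \<psi>' (x - y)) (at 0)"
        using part by (simp add: has_partial_def DERIV_def)
      moreover have "filterlim h (at 0) sequentially"
        using h h0 by (auto simp: filterlim_at)
      ultimately show ?thesis by (rule filterlim_compose)
    qed
    then show "AE y in lborel. (\<lambda>n. F y * ?q n y) \<longlonglongrightarrow> F y * \<psi>' (x - y)"
      by (intro AE_I2 tendsto_mult tendsto_const)
    have "\<bar>?q n y\<bar> \<le> C'" for n y
    proof -
      have "\<bar>\<psi> (x - y + h n *\<^sub>R i) - \<psi> (x - y)\<bar> \<le> C' * \<bar>h n\<bar>"
        by (rule has_partial_lipschitz[OF part bd(2)])
      then show ?thesis
        using h0 by (simp add: abs_divide pos_divide_le_eq)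
    qed
    from mult_right_mono[OF this abs_ge_zero]
    show "AE y in lborel. norm (F y * ?q n y) \<le> C' * \<bar>F y\<bar>" for n
      by (intro AE_I2) (simp add: abs_mult mult.commute)
  qed
  moreover have "(\<integral>y. F y * ?q n y \<partial>lborel)
      = (mollify F \<psi> (x + (0 + h n) *\<^sub>R i) - mollify F \<psi> (x + 0 *\<^sub>R i)) / h n" for n
  proof -
    have "(\<integral>y. F y * ?q n y \<partial>lborel)
        = (\<integral>y. (F y * \<psi> (x + h n *\<^sub>R i - y) - F y * \<psi> (x - y)) / h n \<partial>lborel)"
      by (intro Bochner_Integration.integral_cong) (auto simp: algebra_simps diff_divide_distrib)
    also have "\<dots> = (mollify F \<psi> (x + h n *\<^sub>R i) - mollify F \<psi> x) / h n"
      by (simp add: mollify_def mollify_integrable[OF F cont(1) bd(1)])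
    finally show ?thesis by simp
  qed
  ultimately show "((\<lambda>h. (mollify F \<psi> (x + (0 + h) *\<^sub>R i) - mollify F \<psi> (x + 0 *\<^sub>R i)) / h) \<circ> h)
      \<longlonglongrightarrow> mollify F \<psi>' x"
    by (simp only: o_def mollify_def)
qed

lemma mollify_diff:
  fixes F :: "'a::euclidean_space \<Rightarrow> real"
  assumes "integrable lborel F" "integrable lborel G" "continuous_on UNIV \<psi>" "\<And>x. \<bar>\<psi> x\<bar> \<le> C"
  shows "mollify (\<lambda>x. F x - G x) \<psi> x = mollify F \<psi> x - mollify G \<psi> x"
  using mollify_integrable[OF assms(1,3,4)] mollify_integrable[OF assms(2,3,4)]
  by (simp add: mollify_def left_diff_distrib)

lemma mollify_diff_eq:
  fixes F :: "'a::euclidean_space \<Rightarrow> real"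
  assumes F: "integrable lborel F" and \<eta>: "mollifier \<rho> \<eta>"
  shows "integrable lborel (\<lambda>y. (F y - F x) * \<eta> (x - y))"
    and "mollify F \<eta> x - F x = (\<integral>y. (F y - F x) * \<eta> (x - y) \<partial>lborel)"
proof -
  obtain C where C: "\<And>x. \<bar>\<eta> x\<bar> \<le> C"
    using mollifier_bounded[OF \<eta>] by blast
  have int: "integrable lborel (\<lambda>y. F y * \<eta> (x - y))"
    using mollify_integrable[OF F mollifier_continuous[OF \<eta>] C] .
  show "integrable lborel (\<lambda>y. (F y - F x) * \<eta> (x - y))"
    using int mollifier_reflected[OF \<eta>] by (simp add: left_diff_distrib)
  show "mollify F \<eta> x - F x = (\<integral>y. (F y - F x) * \<eta> (x - y) \<partial>lborel)"
    using int mollifier_reflected[OF \<eta>] by (simp add: left_diff_distrib mollify_def)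
qed

text \<open>The mollification is an average of \<open>F\<close> over the ball of radius \<open>\<rho>\<close>, so it moves a value at most by
the oscillation of \<open>F\<close> there.\<close>

lemma mollify_uniform:
  fixes F :: "'a::euclidean_space \<Rightarrow> real"
  assumes F: "integrable lborel F" and \<eta>: "mollifier \<rho> \<eta>"
    and osc: "\<And>y. dist x y < \<rho> \<Longrightarrow> \<bar>F y - F x\<bar> \<le> \<tau>"
  shows "\<bar>mollify F \<eta> x - F x\<bar> \<le> \<tau>"
proof -
  have "\<bar>mollify F \<eta> x - F x\<bar> \<le> (\<integral>y. \<bar>(F y - F x) * \<eta> (x - y)\<bar> \<partial>lborel)"
    unfolding mollify_diff_eq(2)[OF F \<eta>] by (rule integral_abs_bound)
  also have "\<dots> \<le> (\<integral>y. \<tau> * \<eta> (x - y) \<partial>lborel)"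
  proof (rule integral_mono)
    show "integrable lborel (\<lambda>y. \<bar>(F y - F x) * \<eta> (x - y)\<bar>)"
      using mollify_diff_eq(1)[OF F \<eta>] by (rule integrable_abs)
    show "integrable lborel (\<lambda>y. \<tau> * \<eta> (x - y))"
      using mollifier_reflected[OF \<eta>] by simp
    show "\<bar>(F y - F x) * \<eta> (x - y)\<bar> \<le> \<tau> * \<eta> (x - y)" for y
    proof (cases "dist x y < \<rho>")
      case True
      then show ?thesis
        using osc mollifier_nonneg[OF \<eta>] by (simp add: abs_mult mult_right_mono)
    next
      case False
      then show ?thesis
        using mollifier_zero[OF \<eta>, of "x - y"] by (simp add: dist_norm)
    qed
  qed
  also have "\<dots> = \<tau>"
    using mollifier_reflected[OF \<eta>] by simp
  finally show ?thesis .
qed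

lemma mollify_mono:
  fixes F :: "'a::euclidean_space \<Rightarrow> real"
  assumes F: "integrable lborel F" "integrable lborel G" and \<eta>: "mollifier \<rho> \<eta>"
    and K: "cball x \<rho> \<subseteq> K" and le: "AE y in lborel. y \<in> K \<longrightarrow> F y \<le> G y"
  shows "mollify F \<eta> x \<le> mollify G \<eta> x"
proof -
  obtain C where C: "\<And>x. \<bar>\<eta> x\<bar> \<le> C"
    using mollifier_bounded[OF \<eta>] by blast
  show ?thesis
    unfolding mollify_def
  proof (rule integral_mono_AE)
    show "integrable lborel (\<lambda>y. F y * \<eta> (x - y))" "integrable lborel (\<lambda>y. G y * \<eta> (x - y))"
      using mollify_integrable[OF _ mollifier_continuous[OF \<eta>] C] F by blast+
    show "AE y in lborel. F y * \<eta> (x - y) \<le> G y * \<eta> (x - y)"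
      using le
    proof eventually_elim
      case (elim y)
      show ?case
      proof (cases "y \<in> K")
        case True
        then show ?thesis
          using elim mollifier_nonneg[OF \<eta>] by (intro mult_right_mono) auto
      next
        case False
        then have "\<not> dist x y \<le> \<rho>"
          using K by auto
        then show ?thesis
          using mollifier_zero[OF \<eta>, of "x - y"] by (simp add: dist_norm)
      qed
    qed
  qed
qed

lemma mollify_sum:
  fixes F :: "'i \<Rightarrow> 'a::euclidean_space \<Rightarrow> real"
  assumes F: "\<And>i. i \<in> I \<Longrightarrow> integrable lborel (F i)" and \<eta>: "mollifier \<rho> \<eta>"
  shows "mollify (\<lambda>y. \<Sum>i\<in>I. F i y) \<eta> x = (\<Sum>i\<in>I. mollify (F i) \<eta> x)"
proof -
  obtain C where C: "\<And>x. \<bar>\<eta> x\<bar> \<le> C"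
    using mollifier_bounded[OF \<eta>] by blast
  show ?thesis
    using mollify_integrable[OF F mollifier_continuous[OF \<eta>] C]
    by (simp add: mollify_def sum_distrib_right)
qed

lemma mollify_cmult: "mollify (\<lambda>y. c * F y) \<eta> x = c * mollify F \<eta> x"
  by (simp add: mollify_def mult.assoc)

section \<open>Convergence of mollifications in the mean\<close>

lemma ex_compact_open_approx:
  fixes A :: "'a::euclidean_space set"
  assumes A: "A \<in> sets lborel" "emeasure lborel A < \<infinity>" and "e > 0"
  obtains K U where "compact K" "open U" "K \<subseteq> A" "A \<subseteq> U"
    "emeasure lborel (U - K) < ennreal e"
proof -
  have A': "A \<in> sets lebesgue" "A \<in> sets borel" "emeasure lborel A \<noteq> \<infinity>"
  proof -
    show "A \<in> sets lebesgue"
      using A(1) by (rule sets_completionI_sets)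
  qed (use A in simp_all)
  obtain U where U: "open U" "A \<subseteq> U" "emeasure lebesgue (U - A) < ennreal (e / 2)"
    using sets_lebesgue_outer_open[OF A'(1), of "e / 2"] \<open>e > 0\<close> by (metis half_gt_zero)
  \<comment> \<open>The restriction of Lebesgue measure to \<open>A\<close> is finite, hence inner regular.\<close>
  define M where "M = density lborel (indicator A)"
  have M: "emeasure M B = emeasure lborel (A \<inter> B)" if "B \<in> sets borel" for B
    using that A'(2) by (simp add: M_def emeasure_restricted)
  have "emeasure M A = (SUP K\<in>{K. K \<subseteq> A \<and> compact K}. emeasure M K)"
    using A' M[of UNIV] by (intro inner_regular) (auto simp: M_def)
  moreover have "emeasure M K = emeasure lborel K" if "K \<subseteq> A" "compact K" for K
    using that M[of K] by (simp add: borel_compact Int_absorb1)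
  moreover have "emeasure M A = emeasure lborel A"
    using M[of A] A' by simp
  ultimately have "emeasure lborel A = (SUP K\<in>{K. K \<subseteq> A \<and> compact K}. emeasure lborel K)"
    by simp
  from SUP_approx_ennreal[OF _ exI[THEN ex_in_conv[THEN iffD1]] this A'(3), of "e / 2" "{}"]
  obtain K where K: "K \<subseteq> A" "compact K" and less: "emeasure lborel A < emeasure lborel K + ennreal (e / 2)"
    using \<open>e > 0\<close> by auto
  have "emeasure lborel A = emeasure lborel K + emeasure lborel (A - K)"
    using K A' by (subst plus_emeasure) (auto simp: borel_compact Un_absorb1)
  with less have AK: "emeasure lborel (A - K) < ennreal (e / 2)"
    by (simp add: ennreal_add_left_cancel_less)
  have UA: "emeasure lborel (U - A) < ennreal (e / 2)"
    using U A' by (simp add: borel_open)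
  show thesis
  proof
    have meas: "U - A \<in> sets borel" "A - K \<in> sets borel"
      using U A' K by (simp_all add: sets.Diff borel_compact borel_open)
    have "emeasure lborel (U - K) \<le> emeasure lborel ((U - A) \<union> (A - K))"
      using meas by (intro emeasure_mono) auto
    also have "\<dots> \<le> emeasure lborel (U - A) + emeasure lborel (A - K)"
      using meas by (intro emeasure_subadditive) auto
    also have "\<dots> < ennreal (e / 2) + ennreal (e / 2)"
      using UA AK by (rule add_strict_mono)
    also have "\<dots> = ennreal e"
      using \<open>e > 0\<close> by (simp add: ennreal_plus[symmetric] del: ennreal_plus)
    finally show "emeasure lborel (U - K) < ennreal e" .
  qed (use K U in auto)
qed

text \<open>If the translations by \<open>z\<close> and \<open>-z\<close> do not move \<open>K\<close> out of \<open>U\<close>, then exactly one of \<open>x\<close> and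
\<open>x - z\<close> can lie in \<open>A\<close> only if one of them lies in the thin set \<open>U - K\<close>.\<close>

lemma indicator_translate_le:
  fixes z :: "'a::euclidean_space"
  assumes "K \<subseteq> A" "A \<subseteq> U" and "\<And>x. x \<in> K \<Longrightarrow> x + z \<in> U" and "\<And>x. x \<in> K \<Longrightarrow> x - z \<in> U"
  shows "\<bar>indicator A (x - z) - indicator A x\<bar>
    \<le> (indicator (U - K) (x - z) + indicator (U - K) x :: real)"
  using assms(1,2) assms(3)[of "x - z"] assms(4)[of x]
  by (auto simp: indicator_def split: if_splits)

text \<open>For indicators of sets of finite measure this is regularity of Lebesgue measure; it is preserved by
sums and by \<open>L\<^sup>1\<close> limits, the latter because translations are isometries.\<close>

lemma translation_continuous_L1:
  fixes F :: "'a::euclidean_space \<Rightarrow> real"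
  assumes "integrable lborel F"
  shows "\<forall>e>0. \<exists>r>0. \<forall>z. norm z < r \<longrightarrow> (\<integral>\<^sup>+x. ennreal \<bar>F (x - z) - F x\<bar> \<partial>lborel) < ennreal e"
  using assms
proof (induction F rule: integrable_induct)
  case (base A c)
  show ?case
  proof (intro allI impI)
    fix e :: real assume "e > 0"
    define d where "d = e / (2 * (\<bar>c\<bar> + 1))"
    have "d > 0" using \<open>e > 0\<close> by (simp add: d_def)
    obtain K U where KU: "compact K" "open U" "K \<subseteq> A" "A \<subseteq> U"
        "emeasure lborel (U - K) < ennreal d"
      using ex_compact_open_approx[OF base \<open>d > 0\<close>] .
    obtain r where r: "r > 0" "(\<Union>x\<in>K. ball x r) \<subseteq> U"
      using compact_subset_open_imp_ball_epsilon_subset[of K U] KU by auto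
    have UK [measurable]: "U - K \<in> sets borel"
      using KU by (auto intro: borel_compact)
    have "(\<integral>\<^sup>+x. ennreal \<bar>indicator A (x - z) *\<^sub>R c - indicator A x *\<^sub>R c\<bar> \<partial>lborel) < ennreal e"
      if z: "norm z < r" for z
    proof -
      have *: "x + z \<in> U" "x - z \<in> U" if "x \<in> K" for x
        using that r z by (auto simp: subset_eq dist_norm)
      have "(\<integral>\<^sup>+x. ennreal \<bar>indicator A (x - z) *\<^sub>R c - indicator A x *\<^sub>R c\<bar> \<partial>lborel)
          \<le> (\<integral>\<^sup>+x. ennreal \<bar>c\<bar> * (indicator (U - K) (x - z) + indicator (U - K) x) \<partial>lborel)"
      proof (rule nn_integral_mono)
        fix x
        have "\<bar>indicator A (x - z) *\<^sub>R c - indicator A x *\<^sub>R c\<bar>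
            = \<bar>c\<bar> * \<bar>indicator A (x - z) - indicator A x\<bar>"
          by (simp add: left_diff_distrib[symmetric] abs_mult)
        also have "\<dots> \<le> \<bar>c\<bar> * (indicator (U - K) (x - z) + indicator (U - K) x)"
          using indicator_translate_le[OF KU(3,4) *] by (intro mult_left_mono) auto
        finally have "ennreal \<bar>indicator A (x - z) *\<^sub>R c - indicator A x *\<^sub>R c\<bar> \<le> ennreal \<dots>"
          by (rule ennreal_leI)
        then show "ennreal \<bar>indicator A (x - z) *\<^sub>R c - indicator A x *\<^sub>R c\<bar>
            \<le> ennreal \<bar>c\<bar> * (indicator (U - K) (x - z) + indicator (U - K) x)"
          by (simp add: ennreal_mult ennreal_indicator)
      qed
      also have "\<dots> = ennreal \<bar>c\<bar> * (emeasure lborel (U - K) + emeasure lborel (U - K))"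
        by (simp add: nn_integral_cmult nn_integral_add nn_integral_translate)
      also have "\<dots> \<le> ennreal \<bar>c\<bar> * (ennreal d + ennreal d)"
        using KU(5) by (intro mult_left_mono add_mono) auto
      also have "\<dots> = ennreal (\<bar>c\<bar> * (2 * d))"
        using \<open>d > 0\<close> by (simp add: ennreal_mult[symmetric] ennreal_plus[symmetric] del: ennreal_plus)
      also have "\<dots> < ennreal e"
        using \<open>e > 0\<close> by (intro ennreal_lessI) (auto simp: d_def field_simps add_pos_nonneg)
      finally show ?thesis .
    qed
    then show "\<exists>r>0. \<forall>z. norm z < r \<longrightarrow>
        (\<integral>\<^sup>+x. ennreal \<bar>indicator A (x - z) *\<^sub>R c - indicator A x *\<^sub>R c\<bar> \<partial>lborel) < ennreal e"
      using r(1) by blast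
  qed
next
  case (add F G)
  have [measurable]: "F \<in> borel_measurable borel" "G \<in> borel_measurable borel"
    using add.hyps by auto
  show ?case
  proof (intro allI impI)
    fix e :: real assume "e > 0"
    then have "e / 2 > 0" by simp
    obtain r where r: "r > 0" "\<And>z. norm z < r \<Longrightarrow> (\<integral>\<^sup>+x. ennreal \<bar>F (x - z) - F x\<bar> \<partial>lborel) < ennreal (e / 2)"
      using add.IH(1) \<open>e / 2 > 0\<close> by blast
    obtain s where s: "s > 0" "\<And>z. norm z < s \<Longrightarrow> (\<integral>\<^sup>+x. ennreal \<bar>G (x - z) - G x\<bar> \<partial>lborel) < ennreal (e / 2)"
      using add.IH(2) \<open>e / 2 > 0\<close> by blast
    have "(\<integral>\<^sup>+x. ennreal \<bar>F (x - z) + G (x - z) - (F x + G x)\<bar> \<partial>lborel) < ennreal e"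
      if "norm z < min r s" for z
    proof -
      have "(\<integral>\<^sup>+x. ennreal \<bar>F (x - z) + G (x - z) - (F x + G x)\<bar> \<partial>lborel)
          \<le> (\<integral>\<^sup>+x. ennreal \<bar>F (x - z) - F x\<bar> + ennreal \<bar>G (x - z) - G x\<bar> \<partial>lborel)"
        by (intro nn_integral_mono) (simp add: ennreal_plus[symmetric] del: ennreal_plus)
      also have "\<dots> = (\<integral>\<^sup>+x. ennreal \<bar>F (x - z) - F x\<bar> \<partial>lborel) + (\<integral>\<^sup>+x. ennreal \<bar>G (x - z) - G x\<bar> \<partial>lborel)"
        by (rule nn_integral_add) auto
      also have "\<dots> < ennreal (e / 2) + ennreal (e / 2)"
        using that r s by (intro add_strict_mono) auto
      also have "\<dots> = ennreal e"
        using \<open>e > 0\<close> by (simp add: ennreal_plus[symmetric] del: ennreal_plus)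
      finally show ?thesis .
    qed
    then show "\<exists>r>0. \<forall>z. norm z < r \<longrightarrow>
        (\<integral>\<^sup>+x. ennreal \<bar>F (x - z) + G (x - z) - (F x + G x)\<bar> \<partial>lborel) < ennreal e"
      using r(1) s(1) by (intro exI[of _ "min r s"]) auto
  qed
next
  case (lim F s)
  have [measurable]: "F \<in> borel_measurable borel" "\<And>n. s n \<in> borel_measurable borel"
    using lim.hyps by auto
  have "(\<lambda>n. \<integral>\<^sup>+x. ennreal (norm (F x - s n x)) \<partial>lborel) \<longlonglongrightarrow> 0"
  proof (rule nn_integral_dominated_convergence_norm[where w = "\<lambda>x. 2 * \<bar>F x\<bar>"])
    have "integrable lborel (\<lambda>x. 2 * \<bar>F x\<bar>)"
      using lim.hyps by simp
    then show "(\<integral>\<^sup>+x. ennreal (2 * \<bar>F x\<bar>) \<partial>lborel) < \<infinity>"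
      unfolding integrable_iff_bounded by (simp add: abs_mult)
  qed (use lim.hyps in auto)
  note conv = this
  show ?case
  proof (intro allI impI)
    fix e :: real assume "e > 0"
    then have e: "e / 3 > 0" by simp
    obtain n where n: "(\<integral>\<^sup>+x. ennreal \<bar>F x - s n x\<bar> \<partial>lborel) < ennreal (e / 3)"
      using order_tendstoD(2)[OF conv, of "ennreal (e / 3)"] e
      by (auto simp: eventually_sequentially)
    obtain r where r: "r > 0" "\<And>z. norm z < r \<Longrightarrow> (\<integral>\<^sup>+x. ennreal \<bar>s n (x - z) - s n x\<bar> \<partial>lborel) < ennreal (e / 3)"
      using lim.IH e by blast
    have "(\<integral>\<^sup>+x. ennreal \<bar>F (x - z) - F x\<bar> \<partial>lborel) < ennreal e" if "norm z < r" for z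
    proof -
      have "(\<integral>\<^sup>+x. ennreal \<bar>F (x - z) - F x\<bar> \<partial>lborel)
          \<le> (\<integral>\<^sup>+x. ennreal \<bar>F (x - z) - s n (x - z)\<bar> + ennreal \<bar>s n (x - z) - s n x\<bar>
              + ennreal \<bar>F x - s n x\<bar> \<partial>lborel)"
        by (intro nn_integral_mono) (simp add: ennreal_plus[symmetric] del: ennreal_plus)
      also have "\<dots> = (\<integral>\<^sup>+x. ennreal \<bar>F (x - z) - s n (x - z)\<bar> \<partial>lborel)
          + (\<integral>\<^sup>+x. ennreal \<bar>s n (x - z) - s n x\<bar> \<partial>lborel) + (\<integral>\<^sup>+x. ennreal \<bar>F x - s n x\<bar> \<partial>lborel)"
        by (simp add: nn_integral_add)
      also have "(\<integral>\<^sup>+x. ennreal \<bar>F (x - z) - s n (x - z)\<bar> \<partial>lborel) = (\<integral>\<^sup>+x. ennreal \<bar>F x - s n x\<bar> \<partial>lborel)"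
        by (rule nn_integral_translate[where f = "\<lambda>x. ennreal \<bar>F x - s n x\<bar>"]) auto
      also have "(\<integral>\<^sup>+x. ennreal \<bar>F x - s n x\<bar> \<partial>lborel)
          + (\<integral>\<^sup>+x. ennreal \<bar>s n (x - z) - s n x\<bar> \<partial>lborel) + (\<integral>\<^sup>+x. ennreal \<bar>F x - s n x\<bar> \<partial>lborel)
          < ennreal (e / 3) + ennreal (e / 3) + ennreal (e / 3)"
        using that r n by (intro add_strict_mono) auto
      also have "\<dots> = ennreal e"
        using \<open>e > 0\<close> by (simp add: ennreal_plus[symmetric] del: ennreal_plus)
      finally show ?thesis .
    qed
    then show "\<exists>r>0. \<forall>z. norm z < r \<longrightarrow> (\<integral>\<^sup>+x. ennreal \<bar>F (x - z) - F x\<bar> \<partial>lborel) < ennreal e"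
      using r(1) by blast
  qed
qed

text \<open>Minkowski: the \<open>L\<^sup>1\<close> distance between \<open>F\<close> and its mollification is at most an average, with weight \<open>\<eta> z\<close>, of
the distances between \<open>F\<close> and its translates by \<open>z\<close>.\<close>

lemma mollify_L1:
  fixes F :: "'a::euclidean_space \<Rightarrow> real"
  assumes F: "integrable lborel F" and "e > 0"
  obtains r where "r > 0" "\<And>\<rho> \<eta>. mollifier \<rho> \<eta> \<Longrightarrow> \<rho> \<le> r \<Longrightarrow>
    integrable lborel (\<lambda>x. \<bar>mollify F \<eta> x - F x\<bar>) \<and> (\<integral>x. \<bar>mollify F \<eta> x - F x\<bar> \<partial>lborel) \<le> e"
proof -
  obtain r where r: "r > 0"
      "\<And>z. norm z < r \<Longrightarrow> (\<integral>\<^sup>+x. ennreal \<bar>F (x - z) - F x\<bar> \<partial>lborel) < ennreal e"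
    using translation_continuous_L1[OF F] \<open>e > 0\<close> by blast
  show thesis
  proof (rule that[OF r(1)])
    fix \<rho> and \<eta> :: "'a \<Rightarrow> real" assume \<eta>: "mollifier \<rho> \<eta>" and "\<rho> \<le> r"
    obtain C where C: "\<And>x. \<bar>\<eta> x\<bar> \<le> C"
      using mollifier_bounded[OF \<eta>] by blast
    have [measurable]: "\<eta> \<in> borel_measurable borel"
      using mollifier_continuous[OF \<eta>] by (rule borel_measurable_continuous_onI)
    have [measurable]: "F \<in> borel_measurable borel"
      using F by auto
    have [measurable]: "mollify F \<eta> \<in> borel_measurable borel"
      by (intro borel_measurable_continuous_onI continuous_on_mollify[OF F mollifier_continuous[OF \<eta>] C])
    have pw: "ennreal \<bar>mollify F \<eta> x - F x\<bar> \<le> (\<integral>\<^sup>+z. ennreal \<bar>F (x - z) - F x\<bar> * ennreal (\<eta> z) \<partial>lborel)" for x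
    proof -
      have eq: "(\<lambda>y. (F y - F x) * \<eta> (x - y)) = (\<lambda>y. (F (x - (x - y)) - F x) * \<eta> (x - y))"
        by simp
      have int: "integrable lborel (\<lambda>z. (F (x - z) - F x) * \<eta> z)"
        using mollify_diff_eq(1)[OF F \<eta>, of x] unfolding eq
        by (subst (asm) integrable_reflect_lborel[where f = "\<lambda>z. (F (x - z) - F x) * \<eta> z"]) auto
      have "mollify F \<eta> x - F x = (\<integral>z. (F (x - z) - F x) * \<eta> z \<partial>lborel)"
        unfolding mollify_diff_eq(2)[OF F \<eta>] eq
        by (rule integral_reflect_lborel[where f = "\<lambda>z. (F (x - z) - F x) * \<eta> z"]) auto
      then have "ennreal \<bar>mollify F \<eta> x - F x\<bar> \<le> (\<integral>\<^sup>+z. ennreal (norm ((F (x - z) - F x) * \<eta> z)) \<partial>lborel)"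
        using integral_norm_bound_ennreal[OF int] by simp
      then show ?thesis
        by (simp add: abs_mult ennreal_mult mollifier_nonneg[OF \<eta>])
    qed
    have "(\<integral>\<^sup>+x. ennreal \<bar>mollify F \<eta> x - F x\<bar> \<partial>lborel)
        \<le> (\<integral>\<^sup>+x. \<integral>\<^sup>+z. ennreal \<bar>F (x - z) - F x\<bar> * ennreal (\<eta> z) \<partial>lborel \<partial>lborel)"
      by (intro nn_integral_mono pw)
    also have "\<dots> = (\<integral>\<^sup>+z. \<integral>\<^sup>+x. ennreal \<bar>F (x - z) - F x\<bar> * ennreal (\<eta> z) \<partial>lborel \<partial>lborel)"
      by (rule lborel_pair.Fubini'[symmetric]) measurable
    also have "\<dots> = (\<integral>\<^sup>+z. (\<integral>\<^sup>+x. ennreal \<bar>F (x - z) - F x\<bar> \<partial>lborel) * ennreal (\<eta> z) \<partial>lborel)"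
      by (simp add: nn_integral_multc)
    also have "\<dots> \<le> (\<integral>\<^sup>+z. ennreal e * ennreal (\<eta> z) \<partial>lborel)"
    proof (rule nn_integral_mono)
      fix z
      show "(\<integral>\<^sup>+x. ennreal \<bar>F (x - z) - F x\<bar> \<partial>lborel) * ennreal (\<eta> z) \<le> ennreal e * ennreal (\<eta> z)"
      proof (cases "norm z < \<rho>")
        case True
        then show ?thesis
          using r(2)[of z] \<open>\<rho> \<le> r\<close> by (intro mult_right_mono) auto
      next
        case False
        then show ?thesis using mollifier_zero[OF \<eta>, of z] by simp
      qed
    qed
    also have "\<dots> = ennreal e * ennreal (\<integral>z. \<eta> z \<partial>lborel)"
      using nn_integral_eq_integral[OF mollifier_integrable[OF \<eta>]] mollifier_nonneg[OF \<eta>]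
      by (simp add: nn_integral_cmult)
    also have "\<dots> = ennreal e"
      by (simp add: mollifier_integral[OF \<eta>])
    finally have le: "(\<integral>\<^sup>+x. ennreal \<bar>mollify F \<eta> x - F x\<bar> \<partial>lborel) \<le> ennreal e" .
    have int: "integrable lborel (\<lambda>x. \<bar>mollify F \<eta> x - F x\<bar>)"
      using le by (auto simp: integrable_iff_bounded intro: le_less_trans)
    moreover have "(\<integral>x. \<bar>mollify F \<eta> x - F x\<bar> \<partial>lborel) \<le> e"
      using le nn_integral_eq_integral[OF int] \<open>e > 0\<close> by simp
    ultimately show "integrable lborel (\<lambda>x. \<bar>mollify F \<eta> x - F x\<bar>)
        \<and> (\<integral>x. \<bar>mollify F \<eta> x - F x\<bar> \<partial>lborel) \<le> e" ..
  qed
qed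

section \<open>Weak derivatives tested against mollification kernels\<close>

text \<open>Weak derivatives are Lebesgue measurable functions that are only determined almost everywhere in \<open>\<Omega>\<close>. Replacing
them near a compact set by Borel functions that are integrable on the whole space makes
convolutions and Tonelli's theorem directly applicable.\<close>

definition local_rep :: "'a::euclidean_space set \<Rightarrow> ('a \<Rightarrow> real) \<Rightarrow> ('a \<Rightarrow> real) \<Rightarrow> bool" where
  "local_rep K f F \<longleftrightarrow> integrable lborel F \<and> (AE x in lborel. x \<in> K \<longrightarrow> F x = f x)"

lemma Lp_loc_measurable:
  assumes "Lp_loc p \<Omega> f" "open \<Omega>"
  shows "(\<lambda>x. indicator \<Omega> x *\<^sub>R f x) \<in> borel_measurable lebesgue"
  using assms by (auto simp: Lp_loc_def borel_measurable_restrict_space_iff)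

lemma ex_local_rep:
  fixes f :: "'a::euclidean_space \<Rightarrow> real"
  assumes f: "Lp_loc 1 \<Omega> f" and \<Omega>: "open \<Omega>" and K: "compact K" "K \<subseteq> \<Omega>"
  obtains F where "local_rep K f F"
proof -
  let ?f = "\<lambda>x. indicator K x *\<^sub>R f x"
  have K': "K \<in> sets borel" "K \<in> sets lebesgue"
    using K(1) by (auto simp: borel_compact)
  have eq: "?f = (\<lambda>x. indicator K x *\<^sub>R (indicator \<Omega> x *\<^sub>R f x))"
    using K(2) by (fastforce simp: indicator_def)
  have meas: "?f \<in> borel_measurable lebesgue"
    unfolding eq
    by (rule borel_measurable_scaleR[OF borel_measurable_indicator[OF K'(2)] Lp_loc_measurable[OF f \<Omega>]])
  have "integrable lebesgue (\<lambda>x. indicator K x *\<^sub>R (\<bar>f x\<bar> powr 1))"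
    using f K by (auto simp: Lp_loc_def set_integrable_def)
  then have int: "integrable lebesgue ?f"
    by (rule Bochner_Integration.integrable_bound[OF _ meas]) (auto simp: abs_mult)
  obtain F where F: "F \<in> borel_measurable lborel" "AE x in lborel. ?f x = F x"
    using completion_ex_borel_measurable_real[OF meas] by blast
  have "integrable lebesgue F"
    using int by (rule integrable_cong_AE_imp)
      (use F in \<open>auto intro: measurable_completion AE_completion\<close>)
  then have "integrable lborel F"
    using F(1) by (simp add: integrable_completion)
  moreover have "AE x in lborel. x \<in> K \<longrightarrow> F x = f x"
    using F(2) by eventually_elim (auto simp: indicator_def)
  ultimately show thesis
    using that by (auto simp: local_rep_def)
qed

lemma integral_local_rep:
  fixes f :: "'a::euclidean_space \<Rightarrow> real"
  assumes f: "Lp_loc 1 \<Omega> f" and \<Omega>: "open \<Omega>" and K: "K \<subseteq> \<Omega>"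
    and F: "local_rep K f F" and h: "continuous_on UNIV h" "\<And>x. x \<notin> K \<Longrightarrow> h x = 0"
  shows "(LINT x|lebesgue_on \<Omega>. f x * h x) = (\<integral>x. F x * h x \<partial>lborel)"
proof -
  have [measurable]: "h \<in> borel_measurable borel" "F \<in> borel_measurable borel"
    using h(1) F by (auto intro: borel_measurable_continuous_onI simp: local_rep_def)
  have h': "h \<in> borel_measurable lebesgue"
    by (rule measurable_completion) simp
  have "(LINT x|lebesgue_on \<Omega>. f x * h x) = (\<integral>x. indicator \<Omega> x *\<^sub>R (f x * h x) \<partial>lebesgue)"
    using \<Omega> by (intro integral_restrict_space) auto
  also have "\<dots> = (\<integral>x. (indicator \<Omega> x *\<^sub>R f x) * h x \<partial>lebesgue)"
    by (simp add: mult.assoc)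
  also have "\<dots> = (\<integral>x. F x * h x \<partial>lebesgue)"
  proof (rule integral_cong_AE)
    show "(\<lambda>x. (indicator \<Omega> x *\<^sub>R f x) * h x) \<in> borel_measurable lebesgue"
      by (rule borel_measurable_times[OF Lp_loc_measurable[OF f \<Omega>] h'])
    show "(\<lambda>x. F x * h x) \<in> borel_measurable lebesgue"
      by (rule measurable_completion) simp
    have "AE x in lborel. (indicator \<Omega> x *\<^sub>R f x) * h x = F x * h x"
      using F[unfolded local_rep_def, THEN conjunct2]
      by eventually_elim (use h(2) K in \<open>auto simp: indicator_def\<close>)
    then show "AE x in lebesgue. (indicator \<Omega> x *\<^sub>R f x) * h x = F x * h x"
      by (rule AE_completion)
  qed
  also have "\<dots> = (\<integral>x. F x * h x \<partial>lborel)"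
    by (rule integral_completion) simp
  finally show ?thesis .
qed

text \<open>The weak derivative relation, tested only against the kernels \<open>\<psi> (x - y)\<close>; the minus sign of the
integration by parts cancels against the one from differentiating in \<open>y\<close>. The support condition
uses the strict inequality \<open>\<rho> < norm y\<close> because in this form it passes from \<open>\<psi>\<close> to its derivatives,
so that the relation can be applied to a derivative of a mollifier.\<close>

definition weak_partial_on :: "'a::euclidean_space set \<Rightarrow> 'a \<Rightarrow> ('a \<Rightarrow> real) \<Rightarrow> ('a \<Rightarrow> real) \<Rightarrow> bool" where
  "weak_partial_on K i F G \<longleftrightarrow>
     (\<forall>\<psi> \<rho> x. (\<forall>k. C_k k \<psi>) \<longrightarrow> (\<forall>y. \<rho> < norm y \<longrightarrow> \<psi> y = 0) \<longrightarrow> cball x \<rho> \<subseteq> K \<longrightarrow>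
        mollify F (partial i \<psi>) x = mollify G \<psi> x)"

lemma has_weak_partial_imp_weak_partial_on:
  fixes f g :: "'a::euclidean_space \<Rightarrow> real"
  assumes fg: "has_weak_partial \<Omega> i f g" and \<Omega>: "open \<Omega>" and i: "i \<in> Basis"
    and K: "K \<subseteq> \<Omega>" and F: "local_rep K f F" and G: "local_rep K g G"
  shows "weak_partial_on K i F G"
  unfolding weak_partial_on_def
proof (intro allI impI)
  fix \<psi> :: "'a \<Rightarrow> real" and \<rho> x
  assume \<psi>: "\<forall>k. C_k k \<psi>" "\<forall>y. \<rho> < norm y \<longrightarrow> \<psi> y = 0" and x: "cball x \<rho> \<subseteq> K"
  let ?\<phi> = "\<lambda>y. \<psi> (x - y)"
  have smooth: "C_k k ?\<phi>" for k
    using \<psi>(1) by (intro C_k_reflect) auto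
  have out: "?\<phi> y = 0" if "y \<notin> cball x \<rho>" for y
    using that \<psi>(2) by (simp add: dist_norm)
  have supp: "closure {y. ?\<phi> y \<noteq> 0} \<subseteq> cball x \<rho>"
    using out by (intro closure_minimal closed_cball subsetI) blast
  have "test_function \<Omega> ?\<phi>"
    unfolding test_function_def
  proof (intro conjI allI)
    show "compact (closure {y. ?\<phi> y \<noteq> 0})"
      using supp by (auto simp: compact_eq_bounded_closed intro: bounded_subset[OF bounded_cball])
    show "closure {y. ?\<phi> y \<noteq> 0} \<subseteq> \<Omega>"
      using supp x K by blast
  qed (rule smooth)
  then have weak: "(LINT y|lebesgue_on \<Omega>. f y * partial i ?\<phi> y) = - (LINT y|lebesgue_on \<Omega>. g y * ?\<phi> y)"
    using fg by (simp add: has_weak_partial_def)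
  have partial_\<phi>: "partial i ?\<phi> y = - partial i \<psi> (x - y)" for y
  proof (rule frechet_derivative_eq[THEN trans])
    have D: "(\<psi> has_derivative frechet_derivative \<psi> (at (x - y))) (at (x - y))"
      using \<psi>(1) C_k_Suc_has_derivative by blast
    have "((\<lambda>y. x - y) has_derivative (\<lambda>h. - h)) (at y)"
      by (auto intro!: derivative_eq_intros)
    from has_derivative_compose[OF this D]
    show "(?\<phi> has_derivative (\<lambda>h. frechet_derivative \<psi> (at (x - y)) (- h))) (at y)" .
    show "frechet_derivative \<psi> (at (x - y)) (- i) = - partial i \<psi> (x - y)"
      using has_derivative_linear[OF D] by (simp add: linear_neg)
  qed
  have "mollify F (partial i \<psi>) x = - (\<integral>y. F y * partial i ?\<phi> y \<partial>lborel)"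
    by (simp add: mollify_def partial_\<phi>)
  also have "(\<integral>y. F y * partial i ?\<phi> y \<partial>lborel) = (LINT y|lebesgue_on \<Omega>. f y * partial i ?\<phi> y)"
  proof (rule integral_local_rep[OF _ \<Omega> K F, symmetric])
    show "Lp_loc 1 \<Omega> f"
      using fg by (simp add: has_weak_partial_def)
    show "continuous_on UNIV (partial i ?\<phi>)"
      using smooth[of "Suc 0"] i by simp
    show "partial i ?\<phi> y = 0" if "y \<notin> K" for y
      unfolding partial_\<phi> using partial_zero_outside[of \<rho> \<psi> "x - y" i] \<psi>(2) that x
      by (auto simp: subset_eq dist_norm)
  qed
  also note weak
  also have "(LINT y|lebesgue_on \<Omega>. g y * ?\<phi> y) = (\<integral>y. G y * ?\<phi> y \<partial>lborel)"
  proof (rule integral_local_rep[OF _ \<Omega> K G])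
    show "Lp_loc 1 \<Omega> g"
      using fg by (simp add: has_weak_partial_def)
    show "continuous_on UNIV ?\<phi>"
      using smooth[of 0] by simp
    show "?\<phi> y = 0" if "y \<notin> K" for y
      using out[of y] that x by blast
  qed
  finally show "mollify F (partial i \<psi>) x = mollify G \<psi> x"
    by (simp add: mollify_def)
qed

lemma weak_partial_on_diff:
  fixes F :: "'a::euclidean_space \<Rightarrow> real"
  assumes FG: "weak_partial_on K i F G" "weak_partial_on K i F' G'" and i: "i \<in> Basis"
    and int: "integrable lborel F" "integrable lborel F'" "integrable lborel G" "integrable lborel G'"
  shows "weak_partial_on K i (\<lambda>x. F x - F' x) (\<lambda>x. G x - G' x)"
  unfolding weak_partial_on_def
proof (intro allI impI)
  fix \<psi> :: "'a \<Rightarrow> real" and \<rho> x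
  assume \<psi>: "\<forall>k. C_k k \<psi>" "\<forall>y. \<rho> < norm y \<longrightarrow> \<psi> y = 0" and x: "cball x \<rho> \<subseteq> K"
  have c: "continuous_on UNIV \<psi>" "continuous_on UNIV (partial i \<psi>)"
    using \<psi>(1)[rule_format, of 0] \<psi>(1)[rule_format, of "Suc 0"] i by simp_all
  obtain C where C: "\<And>x. \<bar>\<psi> x\<bar> \<le> C"
    using bounded_of_ball_support[OF c(1)] \<psi>(2) by metis
  obtain C' where C': "\<And>x. \<bar>partial i \<psi> x\<bar> \<le> C'"
    using bounded_of_ball_support[OF c(2), of \<rho>] \<psi>(2) partial_zero_outside[of \<rho> \<psi>] by metis
  have "mollify (\<lambda>x. F x - F' x) (partial i \<psi>) x = mollify F (partial i \<psi>) x - mollify F' (partial i \<psi>) x"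
    by (rule mollify_diff[OF int(1,2) c(2) C'])
  also have "mollify F (partial i \<psi>) x = mollify G \<psi> x"
    using FG(1) \<psi> x unfolding weak_partial_on_def by blast
  also have "mollify F' (partial i \<psi>) x = mollify G' \<psi> x"
    using FG(2) \<psi> x unfolding weak_partial_on_def by blast
  also have "mollify G \<psi> x - mollify G' \<psi> x = mollify (\<lambda>x. G x - G' x) \<psi> x"
    by (rule mollify_diff[OF int(3,4) c(1) C, symmetric])
  finally show "mollify (\<lambda>x. F x - F' x) (partial i \<psi>) x = mollify (\<lambda>x. G x - G' x) \<psi> x" .
qed

text \<open>The kernel vanishes outside \<open>K\<close>, so only the values of \<open>F\<close> on \<open>K\<close> matter. This allows one fixed
globally defined function \<open>F\<close> to be used for all \<open>K\<close>.\<close>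

lemma weak_partial_on_cong:
  fixes F :: "'a::euclidean_space \<Rightarrow> real"
  assumes FG: "weak_partial_on K i F G" and i: "i \<in> Basis"
    and meas: "integrable lborel F" "integrable lborel F'" and eq: "AE x in lborel. x \<in> K \<longrightarrow> F' x = F x"
  shows "weak_partial_on K i F' G"
  unfolding weak_partial_on_def
proof (intro allI impI)
  fix \<psi> :: "'a \<Rightarrow> real" and \<rho> x
  assume \<psi>: "\<forall>k. C_k k \<psi>" "\<forall>y. \<rho> < norm y \<longrightarrow> \<psi> y = 0" and x: "cball x \<rho> \<subseteq> K"
  have "continuous_on UNIV (partial i \<psi>)"
    using \<psi>(1)[rule_format, of "Suc 0"] i by simp
  then have [measurable]: "partial i \<psi> \<in> borel_measurable borel"
    by (rule borel_measurable_continuous_onI)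
  have "mollify F' (partial i \<psi>) x = mollify F (partial i \<psi>) x"
    unfolding mollify_def
  proof (rule integral_cong_AE)
    show "AE y in lborel. F' y * partial i \<psi> (x - y) = F y * partial i \<psi> (x - y)"
      using eq
    proof eventually_elim
      case (elim y)
      then show ?case
        using partial_zero_outside[of \<rho> \<psi> "x - y" i] \<psi>(2) x
        by (cases "y \<in> K") (auto simp: subset_eq dist_norm)
    qed
  qed (use meas in measurable)
  also have "\<dots> = mollify G \<psi> x"
    using FG \<psi> x unfolding weak_partial_on_def by blast
  finally show "mollify F' (partial i \<psi>) x = mollify G \<psi> x" .
qed

text \<open>The chosen representatives \<open>weak_partial\<close> are genuine weak derivatives, since the space guarantees
that some weak derivative exists at both levels.\<close>

lemma W_loc_2D:
  fixes f :: "'a::euclidean_space \<Rightarrow> real"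
  assumes "W_loc 2 p \<Omega> f" "i \<in> Basis"
  shows "has_weak_partial \<Omega> i f (weak_partial \<Omega> i f)"
    and "has_weak_partial \<Omega> i (weak_partial \<Omega> i f) (weak_partial \<Omega> i (weak_partial \<Omega> i f))"
proof -
  have W: "W_loc (Suc (Suc 0)) p \<Omega> f"
    using assms(1) by (simp only: numeral_2_eq_2)
  have "\<exists>g. has_weak_partial \<Omega> i f g"
    using W assms(2) by auto
  then show "has_weak_partial \<Omega> i f (weak_partial \<Omega> i f)"
    unfolding weak_partial_def by (rule someI_ex)
  have "\<exists>g. has_weak_partial \<Omega> i (weak_partial \<Omega> i f) g"
    using W assms(2) by auto
  then show "has_weak_partial \<Omega> i (weak_partial \<Omega> i f) (weak_partial \<Omega> i (weak_partial \<Omega> i f))"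
    unfolding weak_partial_def[of \<Omega> i "weak_partial \<Omega> i f"] by (rule someI_ex)
qed

lemma W_loc_2_imp_weak_partial_on:
  fixes f :: "'a::euclidean_space \<Rightarrow> real"
  assumes f: "W_loc 2 p \<Omega> f" and \<Omega>: "open \<Omega>" and K: "compact K" "K \<subseteq> \<Omega>"
  obtains F G H where "local_rep K f F"
    "\<And>i. i \<in> Basis \<Longrightarrow> local_rep K (weak_partial \<Omega> i f) (G i)"
    "\<And>i. i \<in> Basis \<Longrightarrow> local_rep K (weak_partial \<Omega> i (weak_partial \<Omega> i f)) (H i)"
    "\<And>i. i \<in> Basis \<Longrightarrow> weak_partial_on K i F (G i)"
    "\<And>i. i \<in> Basis \<Longrightarrow> weak_partial_on K i (G i) (H i)"
proof -
  note d = W_loc_2D[OF f]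
  have L: "Lp_loc 1 \<Omega> f" "Lp_loc 1 \<Omega> (weak_partial \<Omega> i f)"
    "Lp_loc 1 \<Omega> (weak_partial \<Omega> i (weak_partial \<Omega> i f))" if "i \<in> Basis" for i
    using d[OF that] by (simp_all add: has_weak_partial_def)
  obtain F where F: "local_rep K f F"
    using ex_local_rep[OF L(1) \<Omega> K] nonempty_Basis by blast
  have "\<forall>i\<in>Basis. \<exists>G. local_rep K (weak_partial \<Omega> i f) G"
    using ex_local_rep[OF L(2) \<Omega> K] by metis
  then obtain G where G: "\<And>i. i \<in> Basis \<Longrightarrow> local_rep K (weak_partial \<Omega> i f) (G i)"
    by metis
  have "\<forall>i\<in>Basis. \<exists>H. local_rep K (weak_partial \<Omega> i (weak_partial \<Omega> i f)) H"
    using ex_local_rep[OF L(3) \<Omega> K] by metis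
  then obtain H where H: "\<And>i. i \<in> Basis \<Longrightarrow> local_rep K (weak_partial \<Omega> i (weak_partial \<Omega> i f)) (H i)"
    by metis
  show thesis
  proof (rule that[OF F G H])
    show "weak_partial_on K i F (G i)" if "i \<in> Basis" for i
      using has_weak_partial_imp_weak_partial_on[OF d(1)[OF that] \<Omega> that K(2) F G[OF that]] .
    show "weak_partial_on K i (G i) (H i)" if "i \<in> Basis" for i
      using has_weak_partial_imp_weak_partial_on[OF d(2)[OF that] \<Omega> that K(2) G[OF that] H[OF that]] .
  qed
qed

section \<open>Mollified differential inequalities\<close>

text \<open>A field is given by its family of coordinate functions, indexed by the basis vectors, since weak
derivatives and mollifications are taken one coordinate at a time.\<close>

definition field_of :: "('a \<Rightarrow> 'b \<Rightarrow> real) \<Rightarrow> 'b \<Rightarrow> 'a::euclidean_space" where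
  "field_of p x = (\<Sum>i\<in>Basis. p i x *\<^sub>R i)"

lemma norm_field_sq: "(\<Sum>i\<in>Basis. (p i x)\<^sup>2) = (norm (field_of p x))\<^sup>2"
proof -
  have "field_of p x \<bullet> i = p i x" if "i \<in> Basis" for i
    using that by (simp add: field_of_def)
  then have "(\<Sum>i\<in>Basis. (p i x)\<^sup>2) = field_of p x \<bullet> field_of p x"
    by (subst euclidean_inner) (simp add: power2_eq_square)
  then show ?thesis by (simp add: power2_norm_eq_inner)
qed

lemma norm_field_diff_le: "norm (field_of p x - field_of q x) \<le> (\<Sum>i\<in>Basis. \<bar>p i x - q i x\<bar>)"
proof -
  have "field_of p x - field_of q x = (\<Sum>i\<in>Basis. (p i x - q i x) *\<^sub>R i)"
    by (simp add: field_of_def sum_subtractf scaleR_left_diff_distrib)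
  also have "norm \<dots> \<le> (\<Sum>i\<in>Basis. norm ((p i x - q i x) *\<^sub>R i))"
    by (rule norm_sum)
  finally show ?thesis by simp
qed

lemma field_of_add: "field_of (\<lambda>i x. p i x + q i x) x = field_of p x + field_of q x"
  by (simp add: field_of_def scaleR_left_distrib sum.distrib)

lemma field_of_cong: "(\<And>i. i \<in> Basis \<Longrightarrow> p i x = q i x) \<Longrightarrow> field_of p x = field_of q x"
  by (simp add: field_of_def)

lemma integrable_norm_field:
  fixes G :: "'a::euclidean_space \<Rightarrow> 'a \<Rightarrow> real"
  assumes "\<And>i. i \<in> Basis \<Longrightarrow> integrable lborel (G i)"
  shows "integrable lborel (\<lambda>y. norm (field_of G y))"
  unfolding field_of_def using assms
  by (intro integrable_norm Bochner_Integration.integrable_sum integrable_scaleR_left)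

text \<open>The \<open>L\<^sup>1\<close>-small majorant of \<open>\<bar>G\<bar> * \<eta> - \<bar>G * \<eta>\<bar>\<close>, the price of interchanging the norm of a gradient
with mollification.\<close>

definition mollify_error :: "('a::euclidean_space \<Rightarrow> 'a \<Rightarrow> real) \<Rightarrow> ('a \<Rightarrow> real) \<Rightarrow> 'a \<Rightarrow> real" where
  "mollify_error G \<eta> x = \<bar>mollify (\<lambda>y. norm (field_of G y)) \<eta> x - norm (field_of G x)\<bar>
     + (\<Sum>i\<in>Basis. \<bar>mollify (G i) \<eta> x - G i x\<bar>)"

lemma mollify_error_nonneg: "mollify_error G \<eta> x \<ge> 0"
  by (simp add: mollify_error_def sum_nonneg)

text \<open>Averaging \<open>\<Delta>z \<ge> - B \<bar>\<nabla>z\<bar>\<close> against \<open>\<eta>\<close> bounds the mollified Laplacian by the average of \<open>\<bar>\<nabla>z\<bar>\<close>,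
which exceeds the norm of the averaged gradient by at most the mollification error.\<close>

lemma mollified_differential_inequality:
  fixes G H :: "'a::euclidean_space \<Rightarrow> 'a \<Rightarrow> real"
  assumes B: "B \<ge> 0"
    and G: "\<And>i. i \<in> Basis \<Longrightarrow> integrable lborel (G i)"
    and H: "\<And>i. i \<in> Basis \<Longrightarrow> integrable lborel (H i)"
    and ineq: "AE y in lborel. y \<in> K \<longrightarrow> (\<Sum>i\<in>Basis. H i y) \<ge> - B * norm (field_of G y)"
    and \<eta>: "mollifier \<rho> \<eta>" and x: "cball x \<rho> \<subseteq> K"
  shows "(\<Sum>i\<in>Basis. mollify (H i) \<eta> x)
    \<ge> - B * (norm (field_of (\<lambda>i. mollify (G i) \<eta>) x) + mollify_error G \<eta> x)"
proof -
  have N: "integrable lborel (\<lambda>y. norm (field_of G y))"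
    by (rule integrable_norm_field[OF G])
  have "- B * mollify (\<lambda>y. norm (field_of G y)) \<eta> x = mollify (\<lambda>y. - B * norm (field_of G y)) \<eta> x"
    by (rule mollify_cmult[symmetric])
  also have "\<dots> \<le> mollify (\<lambda>y. \<Sum>i\<in>Basis. H i y) \<eta> x"
    by (rule mollify_mono[OF _ _ \<eta> x]) (use N H ineq in auto)
  also have "\<dots> = (\<Sum>i\<in>Basis. mollify (H i) \<eta> x)"
    by (rule mollify_sum[OF H \<eta>])
  finally have 1: "- B * mollify (\<lambda>y. norm (field_of G y)) \<eta> x \<le> (\<Sum>i\<in>Basis. mollify (H i) \<eta> x)" .
  have "norm (field_of G x) \<le> norm (field_of (\<lambda>i. mollify (G i) \<eta>) x) + norm (field_of (\<lambda>i. mollify (G i) \<eta>) x - field_of G x)"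
    by (metis norm_triangle_sub norm_minus_commute)
  also have "norm (field_of (\<lambda>i. mollify (G i) \<eta>) x - field_of G x) \<le> (\<Sum>i\<in>Basis. \<bar>mollify (G i) \<eta> x - G i x\<bar>)"
    by (rule norm_field_diff_le)
  finally have "mollify (\<lambda>y. norm (field_of G y)) \<eta> x
      \<le> norm (field_of (\<lambda>i. mollify (G i) \<eta>) x) + mollify_error G \<eta> x"
    unfolding mollify_error_def by linarith
  from mult_left_mono[OF this B] 1 show ?thesis by linarith
qed

lemma ex_uniform_radius:
  fixes P :: "'i \<Rightarrow> real \<Rightarrow> bool"
  assumes "finite I" "\<And>i. i \<in> I \<Longrightarrow> \<exists>r>0. \<forall>\<rho>\<le>r. P i \<rho>"
  shows "\<exists>r>0. \<forall>i\<in>I. \<forall>\<rho>\<le>r. P i \<rho>"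
  using assms
proof (induction I)
  case empty
  then show ?case by (auto intro: exI[of _ 1])
next
  case (insert j I)
  obtain r where r: "r > 0" "\<forall>i\<in>I. \<forall>\<rho>\<le>r. P i \<rho>"
    using insert by auto
  obtain s where s: "s > 0" "\<forall>\<rho>\<le>s. P j \<rho>"
    using insert.prems by auto
  show ?case
    by (rule exI[of _ "min r s"]) (use r s in auto)
qed

lemma mollify_error_L1:
  fixes G :: "'a::euclidean_space \<Rightarrow> 'a \<Rightarrow> real"
  assumes G: "\<And>i. i \<in> Basis \<Longrightarrow> integrable lborel (G i)" and e: "e > 0"
  shows "\<exists>r>0. \<forall>\<rho>\<le>r. \<forall>\<eta>. mollifier \<rho> \<eta> \<longrightarrow>
    integrable lborel (mollify_error G \<eta>) \<and> (\<integral>x. mollify_error G \<eta> x \<partial>lborel) \<le> e"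
proof -
  define d where "d = e / (1 + real DIM('a))"
  have "d > 0" using e by (simp add: d_def add_pos_nonneg)
  let ?P = "\<lambda>F \<rho>. \<forall>\<eta>. mollifier \<rho> \<eta> \<longrightarrow>
    integrable lborel (\<lambda>x. \<bar>mollify F \<eta> x - F x\<bar>) \<and> (\<integral>x. \<bar>mollify F \<eta> x - F x\<bar> \<partial>lborel) \<le> d"
  have small: "\<exists>r>0. \<forall>\<rho>\<le>r. ?P F \<rho>" if "integrable lborel F" for F :: "'a \<Rightarrow> real"
    using mollify_L1[OF that \<open>d > 0\<close>] by metis
  obtain r where r: "r > 0" "\<forall>\<rho>\<le>r. ?P (\<lambda>y. norm (field_of G y)) \<rho>"
    using small[of "\<lambda>y. norm (field_of G y)"] integrable_norm_field[of G] G by blast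
  obtain s where s: "s > 0" "\<forall>i\<in>Basis. \<forall>\<rho>\<le>s. ?P (G i) \<rho>"
    using ex_uniform_radius[of Basis "\<lambda>i. ?P (G i)"] small[OF G] by auto
  show ?thesis
  proof (intro exI[of _ "min r s"] conjI allI impI)
    show "min r s > 0" using r s by simp
    fix \<rho> and \<eta> :: "'a \<Rightarrow> real" assume \<rho>: "\<rho> \<le> min r s" and \<eta>: "mollifier \<rho> \<eta>"
    have N: "integrable lborel (\<lambda>x. \<bar>mollify (\<lambda>y. norm (field_of G y)) \<eta> x - norm (field_of G x)\<bar>)"
      "(\<integral>x. \<bar>mollify (\<lambda>y. norm (field_of G y)) \<eta> x - norm (field_of G x)\<bar> \<partial>lborel) \<le> d"
      using r(2) \<rho> \<eta> by auto
    have I: "integrable lborel (\<lambda>x. \<bar>mollify (G i) \<eta> x - G i x\<bar>)"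
      "(\<integral>x. \<bar>mollify (G i) \<eta> x - G i x\<bar> \<partial>lborel) \<le> d" if "i \<in> Basis" for i
      using s(2) \<rho> \<eta> that by auto
    show "integrable lborel (mollify_error G \<eta>)"
      unfolding mollify_error_def[abs_def] using N(1) I(1) by simp
    have "(\<integral>x. mollify_error G \<eta> x \<partial>lborel)
        = (\<integral>x. \<bar>mollify (\<lambda>y. norm (field_of G y)) \<eta> x - norm (field_of G x)\<bar> \<partial>lborel)
          + (\<Sum>i\<in>Basis. \<integral>x. \<bar>mollify (G i) \<eta> x - G i x\<bar> \<partial>lborel)"
      unfolding mollify_error_def using N(1) I(1) by simp
    also have "\<dots> \<le> d + (\<Sum>i\<in>(Basis::'a set). d)"
      using N(2) I(2) by (intro add_mono sum_mono)
    also have "\<dots> = (1 + real DIM('a)) * d"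
      by (simp add: algebra_simps)
    also have "\<dots> = e"
      by (simp add: d_def add_pos_nonneg)
    finally show "(\<integral>x. mollify_error G \<eta> x \<partial>lborel) \<le> e" .
  qed
qed

section \<open>The energy estimate\<close>

text \<open>The difference of the two sides is \<open>2 Y (s - B Y / 4)\<^sup>2\<close>.\<close>

lemma young_pointwise:
  fixes Y s B :: real
  assumes "Y \<ge> 0"
  shows "2 * Y * s\<^sup>2 - B * Y\<^sup>2 * s \<ge> - (B\<^sup>2 * Y ^ 3 / 8)"
proof -
  have "0 \<le> 2 * Y * (s - B * Y / 4)\<^sup>2"
    using assms by simp
  also have "\<dots> = 2 * Y * s\<^sup>2 - B * Y\<^sup>2 * s + B\<^sup>2 * Y ^ 3 / 8"
    by (simp add: power2_eq_square power3_eq_cube algebra_simps)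
  finally show ?thesis by simp
qed

text \<open>The integrand is the divergence of the compactly supported field \<open>Y\<^sup>2 \<nabla>V\<close>.\<close>

lemma integral_positive_part_square_divergence:
  fixes V :: "'a::euclidean_space \<Rightarrow> real" and k :: real
  defines "Y \<equiv> \<lambda>x. max 0 (V x - k)"
  assumes V: "continuous_on UNIV V"
    and P: "\<And>i. i \<in> Basis \<Longrightarrow> has_partial V i (P i)" "\<And>i. i \<in> Basis \<Longrightarrow> continuous_on UNIV (P i)"
    and Q: "\<And>i. i \<in> Basis \<Longrightarrow> has_partial (P i) i (Q i)" "\<And>i. i \<in> Basis \<Longrightarrow> continuous_on UNIV (Q i)"
    and K: "compact K" "\<And>x. x \<notin> K \<Longrightarrow> V x \<le> k"
  shows "integrable lborel (\<lambda>x. 2 * Y x * (norm (field_of P x))\<^sup>2 + (Y x)\<^sup>2 * (\<Sum>i\<in>Basis. Q i x))"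
    and "(\<integral>x. 2 * Y x * (norm (field_of P x))\<^sup>2 + (Y x)\<^sup>2 * (\<Sum>i\<in>Basis. Q i x) \<partial>lborel) = 0"
proof -
  have Y: "continuous_on UNIV Y" "\<And>x. x \<notin> K \<Longrightarrow> Y x = 0"
    unfolding Y_def using V K(2) by (auto intro!: continuous_intros simp: max_absorb1)
  define f where "f i x = 2 * Y x * P i x * P i x + (Y x)\<^sup>2 * Q i x" for i x
  have f: "integrable lborel (f i) \<and> (\<integral>x. f i x \<partial>lborel) = 0" if i: "i \<in> Basis" for i
  proof
    have cont: "continuous_on UNIV (f i)"
      unfolding f_def using Y(1) P(2)[OF i] Q(2)[OF i] by (intro continuous_intros)
    show "integrable lborel (f i)"
      by (rule integrable_of_compact_support[OF cont K(1)]) (simp add: f_def Y(2))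
    have "has_partial (\<lambda>x. (V x - k)) i (P i)"
      using has_partial_add[OF P(1)[OF i] has_partial_const[of "- k"]] by simp
    from has_partial_mult[OF has_partial_compose[OF this DERIV_positive_part_square] Q(1)[OF i]]
    have part: "has_partial (\<lambda>x. (Y x)\<^sup>2 * P i x) i (f i)"
      by (simp add: Y_def f_def[abs_def])
    show "(\<integral>x. f i x \<partial>lborel) = 0"
    proof (rule integral_partial_eq_0[OF part _ cont K(1)])
      show "continuous_on UNIV (\<lambda>x. (Y x)\<^sup>2 * P i x)"
        using Y(1) P(2)[OF i] by (intro continuous_intros)
    qed (simp_all add: f_def Y(2))
  qed
  have eq: "2 * Y x * (norm (field_of P x))\<^sup>2 + (Y x)\<^sup>2 * (\<Sum>i\<in>Basis. Q i x) = (\<Sum>i\<in>Basis. f i x)" for x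
  proof -
    have "f i x = 2 * Y x * (P i x)\<^sup>2 + (Y x)\<^sup>2 * Q i x" for i
      by (simp add: f_def power2_eq_square)
    then show ?thesis
      by (simp add: norm_field_sq[symmetric] sum.distrib sum_distrib_left)
  qed
  show "integrable lborel (\<lambda>x. 2 * Y x * (norm (field_of P x))\<^sup>2 + (Y x)\<^sup>2 * (\<Sum>i\<in>Basis. Q i x))"
    "(\<integral>x. 2 * Y x * (norm (field_of P x))\<^sup>2 + (Y x)\<^sup>2 * (\<Sum>i\<in>Basis. Q i x) \<partial>lborel) = 0"
    unfolding eq using f by (simp_all)
qed

text \<open>The superlevel set where \<open>Y = max 0 (V - k)\<close> is positive lies in \<open>K\<^sub>0\<close>, where the mollified
inequality and the barrier give \<open>\<Delta>V \<ge> \<delta> - B \<bar>\<nabla>V\<bar> - B E\<close> with \<open>E\<close> the mollification error. In the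
divergence identity for \<open>Y\<^sup>2 \<nabla>V\<close>, Young's inequality absorbs the gradient at the cost of
\<open>B\<^sup>2 Y\<^sup>3 / 8\<close>, which is at most \<open>\<delta> Y\<^sup>2 / 2\<close> by the smallness of \<open>\<sigma>\<close>.\<close>

lemma energy_estimate:
  fixes Z T :: "'a::euclidean_space \<Rightarrow> real" and G H T1 T2 :: "'a \<Rightarrow> 'a \<Rightarrow> real"
  defines "V \<equiv> \<lambda>\<eta> x. mollify Z \<eta> x + T x"
  assumes B: "B \<ge> 0" and \<delta>: "\<delta> > 0"
    and Z: "integrable lborel Z"
    and G: "\<And>i. i \<in> Basis \<Longrightarrow> integrable lborel (G i)" "\<And>i. i \<in> Basis \<Longrightarrow> weak_partial_on K i Z (G i)"
    and H: "\<And>i. i \<in> Basis \<Longrightarrow> integrable lborel (H i)" "\<And>i. i \<in> Basis \<Longrightarrow> weak_partial_on K i (G i) (H i)"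
    and ineq: "AE y in lborel. y \<in> K \<longrightarrow> (\<Sum>i\<in>Basis. H i y) \<ge> - B * norm (field_of G y)"
    and T: "continuous_on UNIV T"
      "\<And>i. i \<in> Basis \<Longrightarrow> has_partial T i (T1 i)" "\<And>i. i \<in> Basis \<Longrightarrow> continuous_on UNIV (T1 i)"
      "\<And>i. i \<in> Basis \<Longrightarrow> has_partial (T1 i) i (T2 i)" "\<And>i. i \<in> Basis \<Longrightarrow> continuous_on UNIV (T2 i)"
      "\<And>x. x \<in> K\<^sub>0 \<Longrightarrow> (\<Sum>i\<in>Basis. T2 i x) - B * norm (field_of T1 x) \<ge> \<delta>"
    and \<eta>: "mollifier \<rho> \<eta>" and K\<^sub>0: "compact K\<^sub>0" "\<And>x. x \<in> K\<^sub>0 \<Longrightarrow> cball x \<rho> \<subseteq> K"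
    and V: "\<And>x. x \<notin> K\<^sub>0 \<Longrightarrow> V \<eta> x \<le> k" "\<And>x. V \<eta> x \<le> k + \<sigma>"
    and \<sigma>: "\<sigma> > 0" "B\<^sup>2 * \<sigma> \<le> 4 * \<delta>"
    and err: "integrable lborel (mollify_error G \<eta>)"
  shows "\<delta> / 2 * (\<integral>x. (max 0 (V \<eta> x - k))\<^sup>2 \<partial>lborel)
    \<le> B * \<sigma>\<^sup>2 * (\<integral>x. mollify_error G \<eta> x \<partial>lborel)"
proof -
  define p where "p i = mollify Z (partial i \<eta>)" for i
  define q where "q i = mollify Z (partial i (partial i \<eta>))" for i
  define P where "P i x = p i x + T1 i x" for i x
  define Q where "Q i x = q i x + T2 i x" for i x
  define Y where "Y x = max 0 (V \<eta> x - k)" for x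
  have sm: "C_k k \<eta>" "C_k k (partial i \<eta>)" "C_k k (partial i (partial i \<eta>))" if "i \<in> Basis" for i k
  proof -
    have "C_k (Suc (Suc k)) \<eta>" "C_k (Suc k) \<eta>" "C_k k \<eta>"
      using mollifier_smooth[OF \<eta>] by blast+
    with that show "C_k k \<eta>" "C_k k (partial i \<eta>)" "C_k k (partial i (partial i \<eta>))"
      unfolding C_k.simps by blast+
  qed
  have van: "\<eta> y = 0" "partial i \<eta> y = 0" "partial i (partial i \<eta>) y = 0" if "\<rho> < norm y" for i y
  proof -
    have 0: "\<eta> y = 0" if "\<rho> < norm y" for y
      using that mollifier_zero[OF \<eta>] by simp
    have 1: "partial i \<eta> y = 0" if "\<rho> < norm y" for y
      by (rule partial_zero_outside[OF 0 that])
    show "\<eta> y = 0" "partial i \<eta> y = 0" "partial i (partial i \<eta>) y = 0"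
      using 0[OF that] 1[OF that] partial_zero_outside[OF 1 that] .
  qed
  obtain C0 where C0: "\<And>x. \<bar>\<eta> x\<bar> \<le> C0"
    using mollifier_bounded[OF \<eta>] by blast
  have conv: "has_partial (mollify Z \<eta>) i (p i) \<and> continuous_on UNIV (p i)
      \<and> has_partial (p i) i (q i) \<and> continuous_on UNIV (q i)" if i: "i \<in> Basis" for i
  proof -
    have c: "continuous_on UNIV \<eta>" "continuous_on UNIV (partial i \<eta>)" "continuous_on UNIV (partial i (partial i \<eta>))"
      using sm(1-3)[OF i, of 0] by simp_all
    obtain C1 where C1: "\<And>x. \<bar>partial i \<eta> x\<bar> \<le> C1"
      using bounded_of_ball_support[OF c(2) van(2)] by blast
    obtain C2 where C2: "\<And>x. \<bar>partial i (partial i \<eta>) x\<bar> \<le> C2"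
      using bounded_of_ball_support[OF c(3) van(3)] by blast
    show ?thesis
      unfolding p_def q_def
      using has_partial_mollify[OF Z C_k_has_partial[OF sm(1)[OF i]] c(1,2) C0 C1]
        has_partial_mollify[OF Z C_k_has_partial[OF sm(2)[OF i]] c(2,3) C1 C2]
        continuous_on_mollify[OF Z c(2) C1] continuous_on_mollify[OF Z c(3) C2]
      by blast
  qed
  have contV: "continuous_on UNIV (V \<eta>)"
    unfolding V_def using continuous_on_mollify[OF Z mollifier_continuous[OF \<eta>] C0] T(1)
    by (intro continuous_on_add)
  have div: "integrable lborel (\<lambda>x. 2 * Y x * (norm (field_of P x))\<^sup>2 + (Y x)\<^sup>2 * (\<Sum>i\<in>Basis. Q i x))"
    "(\<integral>x. 2 * Y x * (norm (field_of P x))\<^sup>2 + (Y x)\<^sup>2 * (\<Sum>i\<in>Basis. Q i x) \<partial>lborel) = 0"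
  proof -
    have part: "has_partial (V \<eta>) i (P i)" "has_partial (P i) i (Q i)"
      "continuous_on UNIV (P i)" "continuous_on UNIV (Q i)" if i: "i \<in> Basis" for i
      unfolding V_def P_def[abs_def] Q_def[abs_def]
      using conv[OF i] T(2-5)[OF i] by (auto intro!: has_partial_add continuous_on_add)
    show "integrable lborel (\<lambda>x. 2 * Y x * (norm (field_of P x))\<^sup>2 + (Y x)\<^sup>2 * (\<Sum>i\<in>Basis. Q i x))"
      "(\<integral>x. 2 * Y x * (norm (field_of P x))\<^sup>2 + (Y x)\<^sup>2 * (\<Sum>i\<in>Basis. Q i x) \<partial>lborel) = 0"
      unfolding Y_def
      using integral_positive_part_square_divergence[OF contV part(1,3,2,4) K\<^sub>0(1) V(1)] by simp_all
  qed
  have Y: "0 \<le> Y x" "Y x \<le> \<sigma>" for x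
    using V(2)[of x] \<sigma>(1) by (auto simp: Y_def)
  have contY: "continuous_on UNIV (\<lambda>x. (Y x)\<^sup>2)"
    unfolding Y_def using contV by (intro continuous_intros)
  have Y0: "Y x = 0" if "x \<notin> K\<^sub>0" for x
    using V(1)[OF that] by (simp add: Y_def max_absorb1)
  have intY: "integrable lborel (\<lambda>x. (Y x)\<^sup>2)"
    by (rule integrable_of_compact_support[OF contY K\<^sub>0(1)]) (simp add: Y0)
  have pointwise: "\<delta> / 2 * (Y x)\<^sup>2 - B * \<sigma>\<^sup>2 * mollify_error G \<eta> x
      \<le> 2 * Y x * (norm (field_of P x))\<^sup>2 + (Y x)\<^sup>2 * (\<Sum>i\<in>Basis. Q i x)" for x
  proof (cases "x \<in> K\<^sub>0")
    case False
    then show ?thesis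
      using Y0[OF False] B mollify_error_nonneg[of G \<eta> x] by simp
  next
    case True
    define E where "E = mollify_error G \<eta> x"
    have E: "E \<ge> 0" by (simp add: E_def mollify_error_nonneg)
    have pG: "p i x = mollify (G i) \<eta> x" if "i \<in> Basis" for i
      using G(2)[OF that] mollifier_smooth[OF \<eta>] van(1) K\<^sub>0(2)[OF True]
      unfolding weak_partial_on_def p_def by blast
    \<comment> \<open>Both derivatives are first put on the kernel, then moved to \<open>Z\<close> one at a time.\<close>
    have qH: "q i x = mollify (H i) \<eta> x" if i: "i \<in> Basis" for i
    proof -
      have "q i x = mollify (G i) (partial i \<eta>) x"
        using G(2)[OF i] sm(2)[OF i] van(2) K\<^sub>0(2)[OF True]
        unfolding weak_partial_on_def q_def by blast
      also have "\<dots> = mollify (H i) \<eta> x"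
        using H(2)[OF i] mollifier_smooth[OF \<eta>] van(1) K\<^sub>0(2)[OF True]
        unfolding weak_partial_on_def by blast
      finally show ?thesis .
    qed
    have "field_of (\<lambda>i. mollify (G i) \<eta>) x = field_of p x"
      by (rule field_of_cong) (simp add: pG)
    then have "(\<Sum>i\<in>Basis. q i x) \<ge> - B * (norm (field_of p x) + E)"
      using mollified_differential_inequality[OF B G(1) H(1) ineq \<eta> K\<^sub>0(2)[OF True]] qH
      by (simp add: E_def)
    moreover have "norm (field_of p x) \<le> norm (field_of P x) + norm (field_of T1 x)"
    proof -
      have "field_of p x = field_of P x - field_of T1 x"
        using field_of_add[of p T1 x] by (simp add: P_def[abs_def])
      then show ?thesis by (simp add: norm_triangle_ineq4)
    qed
    then have "B * norm (field_of p x) \<le> B * norm (field_of P x) + B * norm (field_of T1 x)"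
      using mult_left_mono[OF _ B] by (fastforce simp: distrib_left)
    moreover note T(6)[OF True]
    ultimately have L: "(\<Sum>i\<in>Basis. Q i x) \<ge> \<delta> - B * norm (field_of P x) - B * E"
      by (simp add: Q_def sum.distrib algebra_simps)
    have "B\<^sup>2 * Y x \<le> B\<^sup>2 * \<sigma>"
      using Y(2) by (intro mult_left_mono) auto
    then have "B\<^sup>2 * Y x / 8 \<le> \<delta> / 2"
      using \<sigma>(2) by linarith
    then have "(Y x)\<^sup>2 * (B\<^sup>2 * Y x / 8) \<le> (Y x)\<^sup>2 * (\<delta> / 2)"
      by (rule mult_left_mono) simp
    then have f1: "B\<^sup>2 * (Y x) ^ 3 / 8 \<le> \<delta> / 2 * (Y x)\<^sup>2"
      by (simp add: power2_eq_square power3_eq_cube mult_ac)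
    have f2: "2 * Y x * (norm (field_of P x))\<^sup>2 - B * (Y x)\<^sup>2 * norm (field_of P x) \<ge> - (B\<^sup>2 * (Y x) ^ 3 / 8)"
      by (rule young_pointwise[OF Y(1)])
    have "(Y x)\<^sup>2 * (\<Sum>i\<in>Basis. Q i x) \<ge> (Y x)\<^sup>2 * (\<delta> - B * norm (field_of P x) - B * E)"
      using L by (rule mult_left_mono) simp
    then have f3: "(Y x)\<^sup>2 * (\<Sum>i\<in>Basis. Q i x)
        \<ge> 2 * (\<delta> / 2 * (Y x)\<^sup>2) - B * (Y x)\<^sup>2 * norm (field_of P x) - (B * E) * (Y x)\<^sup>2"
      by (simp add: algebra_simps)
    have "(B * E) * (Y x)\<^sup>2 \<le> (B * E) * \<sigma>\<^sup>2"
      using Y B E by (intro mult_left_mono power_mono) auto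
    then have f4: "(B * E) * (Y x)\<^sup>2 \<le> B * \<sigma>\<^sup>2 * E"
      by (simp add: mult_ac)
    have "d - e \<le> p + l" if "c \<le> d" "p - n \<ge> - c" "l \<ge> 2 * d - n - r" "r \<le> e"
      for c d e l n p r :: real
      using that by linarith
    from this[OF f1 f2 f3 f4] show ?thesis
      unfolding E_def .
  qed
  have "(\<integral>x. \<delta> / 2 * (Y x)\<^sup>2 - B * \<sigma>\<^sup>2 * mollify_error G \<eta> x \<partial>lborel)
      \<le> (\<integral>x. 2 * Y x * (norm (field_of P x))\<^sup>2 + (Y x)\<^sup>2 * (\<Sum>i\<in>Basis. Q i x) \<partial>lborel)"
    by (rule integral_mono[OF _ div(1) pointwise]) (use intY err in auto)
  then have "\<delta> / 2 * (\<integral>x. (Y x)\<^sup>2 \<partial>lborel) - B * \<sigma>\<^sup>2 * (\<integral>x. mollify_error G \<eta> x \<partial>lborel) \<le> 0"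
    using intY err unfolding div(2) by simp
  then show ?thesis
    unfolding Y_def by simp
qed

section \<open>The weak maximum principle\<close>

text \<open>A bounded strict subsolution in one variable: the Gaussian centred at distance at least \<open>1\<close> from
\<open>[-R, R]\<close> is so convex there that its second derivative dominates \<open>B\<close> times the first. Boundedness
on the whole line keeps the perturbation small outside \<open>\<Omega>\<close> too. The constant \<open>2 * R + 1\<close> is the
largest distance of a point of \<open>[-R, R]\<close> from the centre \<open>R + 1\<close>.\<close>

lemma barrier:
  fixes B R :: real
  assumes B: "B \<ge> 0" and R: "R \<ge> 0"
  defines "\<theta> \<equiv> \<lambda>t. exp (- (1 + B) * (t - (R + 1))\<^sup>2)"
  defines "\<theta>' \<equiv> \<lambda>t. - 2 * (1 + B) * (t - (R + 1)) * \<theta> t"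
  defines "\<theta>'' \<equiv> \<lambda>t. (4 * (1 + B)\<^sup>2 * (t - (R + 1))\<^sup>2 - 2 * (1 + B)) * \<theta> t"
  shows "(\<theta> has_real_derivative \<theta>' t) (at t)" and "(\<theta>' has_real_derivative \<theta>'' t) (at t)"
    and "0 < \<theta> t" and "\<theta> t \<le> 1"
    and "\<bar>t\<bar> \<le> R \<Longrightarrow> 2 * exp (- (1 + B) * (2 * R + 1)\<^sup>2) \<le> \<theta>'' t - B * \<bar>\<theta>' t\<bar>"
proof -
  show D: "(\<theta> has_real_derivative \<theta>' t) (at t)" for t
    unfolding \<theta>_def \<theta>'_def by (auto intro!: derivative_eq_intros simp: algebra_simps)
  show "(\<theta>' has_real_derivative \<theta>'' t) (at t)"
    unfolding \<theta>'_def
    by (rule derivative_eq_intros D refl)+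
      (simp add: \<theta>'_def \<theta>''_def algebra_simps power2_eq_square)
  show pos: "0 < \<theta> t"
    by (simp add: \<theta>_def)
  have "0 \<le> (1 + B) * (t - (R + 1))\<^sup>2"
    using B by simp
  then show "\<theta> t \<le> 1"
    by (simp only: \<theta>_def exp_le_one_iff mult_minus_left neg_le_0_iff_le)
  assume t: "\<bar>t\<bar> \<le> R"
  define s where "s = R + 1 - t"
  have s: "1 \<le> s" "s \<le> 2 * R + 1" "s\<^sup>2 = (t - (R + 1))\<^sup>2"
    using t by (auto simp: s_def power2_commute)
  have s2: "s \<le> s\<^sup>2" "1 \<le> s\<^sup>2"
    using s(1) self_le_power[of s 2] by auto
  have "s\<^sup>2 \<le> (2 * R + 1)\<^sup>2"
    using s by (intro power_mono) auto
  then have \<theta>: "exp (- (1 + B) * (2 * R + 1)\<^sup>2) \<le> \<theta> t"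
    using B by (simp add: \<theta>_def s(3)[symmetric] mult_left_mono)
  have "2 * (1 + B) * 1 \<le> 2 * (1 + B) * s\<^sup>2"
    using B s2 by (intro mult_left_mono) auto
  moreover have "2 * B * (1 + B) * s \<le> 2 * B * (1 + B) * s\<^sup>2"
    using B s2 by (intro mult_left_mono) auto
  moreover have "1 * 1 \<le> (1 + B)\<^sup>2 * s\<^sup>2"
    using B s2 by (intro mult_mono) (auto intro: one_le_power)
  moreover have "4 * (1 + B)\<^sup>2 * s\<^sup>2 = 2 * ((1 + B)\<^sup>2 * s\<^sup>2) + 2 * (1 + B) * s\<^sup>2 + 2 * B * (1 + B) * s\<^sup>2"
    by (simp add: algebra_simps power2_eq_square)
  moreover have "B * (2 * (1 + B) * s) = 2 * B * (1 + B) * s"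
    by simp
  ultimately have "2 \<le> 4 * (1 + B)\<^sup>2 * s\<^sup>2 - 2 * (1 + B) - B * (2 * (1 + B) * s)"
    by linarith
  then have "2 * \<theta> t \<le> (4 * (1 + B)\<^sup>2 * s\<^sup>2 - 2 * (1 + B) - B * (2 * (1 + B) * s)) * \<theta> t"
    using pos by (intro mult_right_mono) auto
  also have "\<dots> = \<theta>'' t - B * \<bar>\<theta>' t\<bar>"
  proof -
    have "\<theta>' t = 2 * (1 + B) * s * \<theta> t"
      by (simp add: \<theta>'_def s_def algebra_simps)
    then have "\<bar>\<theta>' t\<bar> = 2 * (1 + B) * s * \<theta> t"
      using B s pos by simp
    then show ?thesis
      unfolding \<theta>''_def s(3)[symmetric] by (simp add: algebra_simps)
  qed
  finally show "2 * exp (- (1 + B) * (2 * R + 1)\<^sup>2) \<le> \<theta>'' t - B * \<bar>\<theta>' t\<bar>"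
    using \<theta> by simp
qed

lemma uniformly_continuous_compact_support:
  fixes f :: "'a::euclidean_space \<Rightarrow> real"
  assumes cont: "continuous_on UNIV f" and supp: "\<And>x. R < norm x \<Longrightarrow> f x = 0" and "\<tau> > 0"
  obtains r where "r > 0" "\<And>x y. dist x y < r \<Longrightarrow> \<bar>f y - f x\<bar> < \<tau>"
proof -
  have "uniformly_continuous_on (cball 0 (R + 1)) f"
    using cont by (intro compact_uniformly_continuous) (auto intro: continuous_on_subset)
  then obtain d where d: "d > 0"
      "\<And>x y. x \<in> cball 0 (R + 1) \<Longrightarrow> y \<in> cball 0 (R + 1) \<Longrightarrow> dist y x < d \<Longrightarrow> dist (f y) (f x) < \<tau>"
    using \<open>\<tau> > 0\<close> unfolding uniformly_continuous_on_def by metis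
  show thesis
  proof (rule that[of "min d 1"])
    fix x y :: 'a assume xy: "dist x y < min d 1"
    have n: "norm y \<le> norm x + dist x y" "norm x \<le> norm y + dist x y"
      using norm_triangle_ineq2[of x y] norm_triangle_ineq2[of y x]
      by (auto simp: dist_norm norm_minus_commute)
    show "\<bar>f y - f x\<bar> < \<tau>"
    proof (cases "norm x \<le> R + 1 \<and> norm y \<le> R + 1")
      case True
      then show ?thesis
        using d(2)[of x y] xy by (simp add: dist_commute dist_real_def)
    next
      case False
      then have "norm x > R" "norm y > R"
        using n xy by auto
      then show ?thesis using supp \<open>\<tau> > 0\<close> by simp
    qed
  qed (use d in auto)
qed

text \<open>The last hypothesis is the weak form of \<open>\<Delta>Z \<ge> - B \<bar>\<nabla>Z\<bar>\<close> near every compact set, with \<open>G\<close> the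
gradient of \<open>Z\<close> and \<open>H\<close> its pure second derivatives. The argument is by contradiction at a point where \<open>Z\<close> has the value \<open>m > 0\<close>. The barrier is scaled
by \<open>m / 4\<close>, which keeps the maximum of the perturbed function inside \<open>\<Omega>\<close>. As the mollification
radius tends to \<open>0\<close>, the left-hand side of the energy estimate stays above a fixed positive number,
because \<open>Y\<close> is bounded below near the maximum point, while the right-hand side tends to \<open>0\<close>.\<close>

lemma weak_maximum_principle:
  fixes Z :: "'a::euclidean_space \<Rightarrow> real"
  assumes \<Omega>: "open \<Omega>" "bounded \<Omega>" and B: "B \<ge> 0"
    and Z: "continuous_on UNIV Z" "\<And>x. x \<notin> \<Omega> \<Longrightarrow> Z x = 0"
    and weak: "\<And>K. compact K \<Longrightarrow> K \<subseteq> \<Omega> \<Longrightarrow> \<exists>G H.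
      (\<forall>i\<in>Basis. integrable lborel (G i) \<and> integrable lborel (H i)
        \<and> weak_partial_on K i Z (G i) \<and> weak_partial_on K i (G i) (H i))
      \<and> (AE y in lborel. y \<in> K \<longrightarrow> (\<Sum>i\<in>Basis. H i y) \<ge> - B * norm (field_of G y))"
  shows "Z x \<le> 0"
proof (rule ccontr)
  assume "\<not> Z x \<le> 0"
  define m where "m = Z x"
  have m: "m > 0" using \<open>\<not> Z x \<le> 0\<close> by (simp add: m_def)
  have x\<Omega>: "x \<in> \<Omega>" using Z(2) m by (force simp: m_def)
  obtain R where R: "\<And>y. y \<in> \<Omega> \<Longrightarrow> norm y \<le> R"
    using \<Omega>(2) bounded_iff by blast
  have R0: "R \<ge> 0" using R[OF x\<Omega>] norm_ge_zero order_trans by blast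
  have supp: "Z y = 0" if "R < norm y" for y
    using R Z(2) that by (meson not_le)
  have intZ: "integrable lborel Z"
    by (rule integrable_of_compact_support[OF Z(1) compact_cball[of 0 R]]) (use supp in auto)
  obtain e :: 'a where e: "e \<in> Basis" by (meson nonempty_Basis ex_in_conv)
  define \<theta> where "\<theta> t = exp (- (1 + B) * (t - (R + 1))\<^sup>2)" for t
  define \<theta>' where "\<theta>' t = - 2 * (1 + B) * (t - (R + 1)) * \<theta> t" for t
  define \<theta>'' where "\<theta>'' t = (4 * (1 + B)\<^sup>2 * (t - (R + 1))\<^sup>2 - 2 * (1 + B)) * \<theta> t" for t
  have \<theta>: "(\<theta> has_real_derivative \<theta>' t) (at t)" "(\<theta>' has_real_derivative \<theta>'' t) (at t)"
    "0 < \<theta> t" "\<theta> t \<le> 1"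
    "\<bar>t\<bar> \<le> R \<Longrightarrow> 2 * exp (- (1 + B) * (2 * R + 1)\<^sup>2) \<le> \<theta>'' t - B * \<bar>\<theta>' t\<bar>" for t
    unfolding \<theta>''_def[abs_def] \<theta>'_def[abs_def] \<theta>_def[abs_def] by (rule barrier[OF B R0]; assumption?)+
  have cont\<theta>: "continuous_on UNIV \<theta>" "continuous_on UNIV \<theta>'" "continuous_on UNIV \<theta>''"
    unfolding \<theta>''_def[abs_def] \<theta>'_def[abs_def] \<theta>_def[abs_def] by (intro continuous_intros)+
  define \<epsilon> where "\<epsilon> = m / 4"
  have \<epsilon>: "\<epsilon> > 0" using m by (simp add: \<epsilon>_def)
  define \<delta> where "\<delta> = \<epsilon> * (2 * exp (- (1 + B) * (2 * R + 1)\<^sup>2))"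
  have \<delta>: "\<delta> > 0" using \<epsilon> by (simp add: \<delta>_def)
  define T where "T y = \<epsilon> * \<theta> (y \<bullet> e)" for y
  define T1 where "T1 i y = \<epsilon> * (\<theta>' (y \<bullet> e) * (i \<bullet> e))" for i y
  define T2 where "T2 i y = \<epsilon> * (\<theta>'' (y \<bullet> e) * (i \<bullet> e) * (i \<bullet> e))" for i y
  have T: "0 \<le> T y" "T y \<le> \<epsilon>" for y
    using mult_left_mono[OF \<theta>(4)[of "y \<bullet> e"], of \<epsilon>] mult_pos_pos[OF \<epsilon> \<theta>(3)[of "y \<bullet> e"]] \<epsilon>
    unfolding T_def by linarith+
  have cont_comp: "continuous_on UNIV (\<lambda>y. f (y \<bullet> e))" if "continuous_on UNIV f" for f :: "real \<Rightarrow> real"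
    by (rule continuous_on_compose2[OF that]) (auto intro: continuous_intros)
  have contT: "continuous_on UNIV T" "continuous_on UNIV (T1 i)" "continuous_on UNIV (T2 i)" for i
    unfolding T_def[abs_def] T1_def[abs_def] T2_def[abs_def] using cont\<theta>[THEN cont_comp]
    by (auto intro!: continuous_intros)
  have part_const_mult: "has_partial (\<lambda>y. c * f y) i (\<lambda>y. c * f' y)" if "has_partial f i f'"
    for c f f' and i :: 'a
    using has_partial_mult[OF has_partial_const[of c] that] by simp
  have partT: "has_partial T i (T1 i)" for i
    unfolding T_def[abs_def] T1_def[abs_def]
    by (intro part_const_mult has_partial_compose[OF has_partial_inner \<theta>(1)])
  have partT1: "has_partial (T1 i) i (T2 i)" for i
  proof -
    have "has_partial (\<lambda>y. (i \<bullet> e) * \<theta>' (y \<bullet> e)) i (\<lambda>y. (i \<bullet> e) * (\<theta>'' (y \<bullet> e) * (i \<bullet> e)))"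
      by (intro part_const_mult has_partial_compose[OF has_partial_inner \<theta>(2)])
    from part_const_mult[OF this, of \<epsilon>] show ?thesis
      by (simp add: T1_def[abs_def] T2_def[abs_def] mult_ac)
  qed
  have bar: "(\<Sum>i\<in>Basis. T2 i y) - B * norm (field_of T1 y) \<ge> \<delta>" if "y \<in> \<Omega>" for y
  proof -
    have "(\<Sum>i\<in>Basis. T2 i y) = (\<Sum>i\<in>Basis. if i = e then \<epsilon> * \<theta>'' (y \<bullet> e) else 0)"
      using e by (intro sum.cong) (auto simp: T2_def inner_Basis)
    then have 1: "(\<Sum>i\<in>Basis. T2 i y) = \<epsilon> * \<theta>'' (y \<bullet> e)"
      using e by simp
    have "field_of T1 y = (\<Sum>i\<in>Basis. if i = e then (\<epsilon> * \<theta>' (y \<bullet> e)) *\<^sub>R e else 0)"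
      unfolding field_of_def using e by (intro sum.cong) (auto simp: T1_def inner_Basis)
    then have 2: "norm (field_of T1 y) = \<epsilon> * \<bar>\<theta>' (y \<bullet> e)\<bar>"
      using e \<epsilon> by (simp add: abs_mult)
    have "\<bar>y \<bullet> e\<bar> \<le> R"
      using R[OF that] Basis_le_norm[OF e, of y] by linarith
    from mult_left_mono[OF \<theta>(5)[OF this], of \<epsilon>] \<epsilon>
    show ?thesis
      unfolding 1 2 \<delta>_def by (simp add: algebra_simps)
  qed
  define \<zeta> where "\<zeta> y = Z y + T y" for y
  have cont\<zeta>: "continuous_on UNIV \<zeta>"
    unfolding \<zeta>_def[abs_def] using Z(1) contT(1) by (rule continuous_on_add)
  obtain y where y: "\<And>z. z \<in> closure \<Omega> \<Longrightarrow> \<zeta> z \<le> \<zeta> y"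
    using continuous_attains_sup[of "closure \<Omega>" \<zeta>] \<Omega>(2) x\<Omega> continuous_on_subset[OF cont\<zeta>]
    by (metis closure_subset compact_closure empty_iff subsetD top_greatest)
  have xy: "m \<le> \<zeta> y"
    using y[of x] x\<Omega> closure_subset T(1)[of x] by (force simp: \<zeta>_def m_def)
  have max: "\<zeta> z \<le> \<zeta> y" for z
  proof (cases "z \<in> \<Omega>")
    case True
    then show ?thesis using y closure_subset by blast
  next
    case False
    then have "\<zeta> z \<le> \<epsilon>" using Z(2) T(2) by (simp add: \<zeta>_def)
    then show ?thesis using xy m by (simp add: \<epsilon>_def)
  qed
  \<comment> \<open>The first bound keeps the superlevel set above \<open>k\<close> inside \<open>\<Omega>\<close>, the second is the smallness condition
    of the energy estimate for \<open>2 * \<sigma>\<close>; the summand \<open>1\<close> covers \<open>B = 0\<close>.\<close>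
  define \<sigma> where "\<sigma> = min (m / 4) (2 * \<delta> / (B\<^sup>2 + 1))"
  have \<sigma>: "\<sigma> > 0" "\<sigma> \<le> m / 4"
    using m \<delta> by (auto simp: \<sigma>_def add_nonneg_pos)
  have "\<sigma> * (B\<^sup>2 + 1) \<le> 2 * \<delta>"
    using pos_le_divide_eq[of "B\<^sup>2 + 1" \<sigma> "2 * \<delta>"] by (simp add: \<sigma>_def add_nonneg_pos)
  then have \<sigma>B: "B\<^sup>2 * (2 * \<sigma>) \<le> 4 * \<delta>"
    using \<sigma>(1) by (simp add: algebra_simps)
  define k where "k = \<zeta> y - \<sigma>"
  define K\<^sub>0 where "K\<^sub>0 = {z. m / 4 \<le> Z z}"
  have K\<^sub>0\<Omega>: "K\<^sub>0 \<subseteq> \<Omega>"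
    using Z(2) m by (force simp: K\<^sub>0_def)
  have K\<^sub>0: "compact K\<^sub>0"
  proof -
    have "closed K\<^sub>0"
      unfolding K\<^sub>0_def using Z(1) by (intro closed_Collect_le continuous_on_const)
    then show ?thesis
      using bounded_subset[OF \<Omega>(2) K\<^sub>0\<Omega>] by (simp add: compact_eq_bounded_closed)
  qed
  obtain d where d: "d > 0" "(\<Union>z\<in>K\<^sub>0. cball z d) \<subseteq> \<Omega>"
    using compact_subset_open_imp_cball_epsilon_subset[OF K\<^sub>0 \<Omega>(1) K\<^sub>0\<Omega>] by metis
  define K where "K = (\<Union>z\<in>K\<^sub>0. cball z d)"
  have K: "compact K" "K \<subseteq> \<Omega>"
  proof -
    have "K = {u + v |u v. u \<in> K\<^sub>0 \<and> v \<in> cball 0 d}"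
    proof (intro set_eqI iffI)
      fix z assume "z \<in> K"
      then obtain u where "u \<in> K\<^sub>0" "dist u z \<le> d" by (auto simp: K_def)
      then have "z = u + (z - u)" "z - u \<in> cball 0 d"
        by (simp_all add: dist_norm norm_minus_commute)
      with \<open>u \<in> K\<^sub>0\<close> show "z \<in> {u + v |u v. u \<in> K\<^sub>0 \<and> v \<in> cball 0 d}"
        by blast
    next
      fix z assume "z \<in> {u + v |u v. u \<in> K\<^sub>0 \<and> v \<in> cball 0 d}"
      then obtain u v where "z = u + v" "u \<in> K\<^sub>0" "norm v \<le> d" by auto
      then show "z \<in> K"
        by (auto simp: K_def dist_norm intro!: bexI[of _ u])
    qed
    then show "compact K"
      using compact_sums[OF K\<^sub>0 compact_cball[of 0 d]] by simp
    show "K \<subseteq> \<Omega>" using d by (simp add: K_def)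
  qed
  obtain G H where GH: "\<forall>i\<in>Basis. integrable lborel (G i) \<and> integrable lborel (H i)
        \<and> weak_partial_on K i Z (G i) \<and> weak_partial_on K i (G i) (H i)"
      "AE y in lborel. y \<in> K \<longrightarrow> (\<Sum>i\<in>Basis. H i y) \<ge> - B * norm (field_of G y)"
    using weak[OF K] by blast
  obtain r where r: "r > 0" "\<And>u v. dist u v < r \<Longrightarrow> \<bar>Z v - Z u\<bar> < \<sigma> / 4"
    by (rule uniformly_continuous_compact_support[OF Z(1), of R "\<sigma> / 4"]) (use supp \<sigma>(1) in auto)
  obtain s where s: "s > 0" "ball y s \<subseteq> {z. \<zeta> y - \<sigma> / 4 < \<zeta> z}"
  proof -
    have "open {z. \<zeta> y - \<sigma> / 4 < \<zeta> z}"
      using cont\<zeta> by (intro open_Collect_less continuous_on_const)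
    moreover have "y \<in> {z. \<zeta> y - \<sigma> / 4 < \<zeta> z}"
      using \<sigma>(1) by simp
    ultimately show thesis
      using that open_contains_ball by blast
  qed
  define c where "c = (\<sigma> / 2)\<^sup>2 * measure lborel (ball y s)"
  have c: "c > 0"
    using \<sigma>(1) content_ball_pos[OF s(1), of y] by (simp add: c_def)
  \<comment> \<open>\<open>c\<close> bounds the integral of \<open>Y\<^sup>2\<close> from below, and \<open>e'\<close> is the size of the mollification error that
    contradicts the energy estimate.\<close>
  define e' where "e' = \<delta> * c / (4 * (B * (2 * \<sigma>)\<^sup>2 + 1))"
  have den: "B * (2 * \<sigma>)\<^sup>2 + 1 > 0"
    using B by (simp add: add_nonneg_pos)
  have e': "e' > 0"
    using \<delta> c den by (simp add: e'_def)
  obtain t where t: "t > 0" "\<And>\<rho> \<eta>. \<rho> \<le> t \<Longrightarrow> mollifier \<rho> \<eta> \<Longrightarrow>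
      integrable lborel (mollify_error G \<eta>) \<and> (\<integral>x. mollify_error G \<eta> x \<partial>lborel) \<le> e'"
    using mollify_error_L1[OF _ e', of G] GH(1) by metis
  define \<rho> where "\<rho> = min d (min r t)"
  have \<rho>: "\<rho> > 0" "\<rho> \<le> d" "\<rho> \<le> r" "\<rho> \<le> t"
    using d r t by (auto simp: \<rho>_def)
  obtain \<eta> :: "'a \<Rightarrow> real" where \<eta>: "mollifier \<rho> \<eta>"
    by (rule ex_mollifier[OF \<rho>(1)])
  have close: "\<bar>mollify Z \<eta> z - Z z\<bar> \<le> \<sigma> / 4" for z
  proof (rule mollify_uniform[OF intZ \<eta>])
    fix v assume "dist z v < \<rho>"
    then have "dist z v < r" using \<rho>(3) by linarith
    from r(2)[OF this] show "\<bar>Z v - Z z\<bar> \<le> \<sigma> / 4" by simp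
  qed
  define V where "V z = mollify Z \<eta> z + T z" for z
  have Vclose: "\<bar>V z - \<zeta> z\<bar> \<le> \<sigma> / 4" for z
    using close[of z] by (simp add: V_def \<zeta>_def)
  \<comment> \<open>Outside \<open>K\<^sub>0\<close> the value of \<open>V\<close> is below \<open>m / 4 + m / 4 + m / 16\<close>, whereas \<open>k\<close> is at least \<open>3 m / 4\<close>.\<close>
  have V0: "V z \<le> k" if "z \<notin> K\<^sub>0" for z
  proof -
    have "Z z < m / 4" using that by (simp add: K\<^sub>0_def)
    then have "V z < m / 4 + m / 4 + \<sigma> / 4"
      using Vclose[of z] T(2)[of z] unfolding \<zeta>_def \<epsilon>_def by linarith
    then show ?thesis
      using \<sigma> xy unfolding k_def by linarith
  qed
  have V1: "V z \<le> k + 2 * \<sigma>" for z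
    using Vclose[of z] max[of z] \<sigma>(1) unfolding k_def by linarith
  have err: "integrable lborel (mollify_error G \<eta>)" "(\<integral>x. mollify_error G \<eta> x \<partial>lborel) \<le> e'"
    using t(2)[OF \<rho>(4) \<eta>] by auto
  have "\<delta> / 2 * (\<integral>x. (max 0 (V x - k))\<^sup>2 \<partial>lborel) \<le> B * (2 * \<sigma>)\<^sup>2 * (\<integral>x. mollify_error G \<eta> x \<partial>lborel)"
    unfolding V_def
  proof (rule energy_estimate[OF B \<delta> intZ _ _ _ _ GH(2) contT(1) partT contT(2) partT1 contT(3) _ \<eta> K\<^sub>0])
    show "cball z \<rho> \<subseteq> K" if "z \<in> K\<^sub>0" for z
      using that \<rho>(2) unfolding K_def by (force simp: subset_iff)
  qed (use GH(1) bar K\<^sub>0\<Omega> V0 V1 \<sigma>(1) \<sigma>B err(1) in \<open>auto simp: V_def\<close>)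
  also have "\<dots> \<le> B * (2 * \<sigma>)\<^sup>2 * e'"
    using err(2) B by (intro mult_left_mono) auto
  also have "\<dots> \<le> (B * (2 * \<sigma>)\<^sup>2 + 1) * e'"
    using e' by (simp add: distrib_right)
  also have "\<dots> = \<delta> * c / 4"
  proof -
    have "D * (a / (4 * D)) = a / 4" if "D > 0" for D a :: real
      using that by simp
    from this[OF den] show ?thesis
      unfolding e'_def .
  qed
  also have "\<dots> < \<delta> / 2 * c"
    using \<delta> c by simp
  also have "\<dots> \<le> \<delta> / 2 * (\<integral>x. (max 0 (V x - k))\<^sup>2 \<partial>lborel)"
  proof -
    have contV: "continuous_on UNIV (\<lambda>x. (max 0 (V x - k))\<^sup>2)"
    proof -
      obtain C where C: "\<And>x. \<bar>\<eta> x\<bar> \<le> C"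
        using mollifier_bounded[OF \<eta>] by blast
      show ?thesis
        unfolding V_def using continuous_on_mollify[OF intZ mollifier_continuous[OF \<eta>] C] contT(1)
        by (intro continuous_intros)
    qed
    have "c = (\<integral>x. (\<sigma> / 2)\<^sup>2 * indicator (ball y s) x \<partial>lborel)"
      by (simp add: c_def)
    also have "\<dots> \<le> (\<integral>x. (max 0 (V x - k))\<^sup>2 \<partial>lborel)"
    proof (rule integral_mono)
      show "integrable lborel (\<lambda>x. (\<sigma> / 2)\<^sup>2 * indicator (ball y s) x)"
        using emeasure_bounded_finite[OF bounded_ball, of y s]
        by (intro integrable_mult_right integrable_real_indicator) simp_all
      show "integrable lborel (\<lambda>x. (max 0 (V x - k))\<^sup>2)"
        by (rule integrable_of_compact_support[OF contV K\<^sub>0]) (simp add: V0 max_absorb1)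
      show "(\<sigma> / 2)\<^sup>2 * indicator (ball y s) z \<le> (max 0 (V z - k))\<^sup>2" for z
      proof (cases "z \<in> ball y s")
        case True
        then have "\<zeta> y - \<sigma> / 4 < \<zeta> z" using s(2) by auto
        then have "\<sigma> / 2 \<le> V z - k"
          using Vclose[of z] unfolding k_def by linarith
        then have "(\<sigma> / 2)\<^sup>2 \<le> (max 0 (V z - k))\<^sup>2"
          using \<sigma>(1) by (intro power_mono) auto
        then show ?thesis using True by simp
      qed simp
    qed
    finally show ?thesis
      using \<delta> by (intro mult_left_mono) auto
  qed
  finally show False by simp
qed

section \<open>Comparison of the two solutions\<close>

lemma AE_lebesgue_on_iff_lborel:
  fixes \<Omega> :: "'a::euclidean_space set"
  assumes "open \<Omega>"
  shows "(AE x in lebesgue_on \<Omega>. P x) \<longleftrightarrow> (AE x in lborel. x \<in> \<Omega> \<longrightarrow> P x)"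
  using assms by (subst AE_restrict_space_iff) (auto simp: AE_completion_iff)

text \<open>Applied with \<open>p = \<nabla>w\<close> and \<open>q = \<nabla>u\<close>. The drift \<open>- B sgn p\<close> is the worst one for \<open>p\<close>: replacing \<open>q\<close> by \<open>p\<close> gives \<open>b \<bullet> p + B \<bar>p\<bar> \<ge> 0\<close>, and the
replacement costs at most \<open>B \<bar>p - q\<bar>\<close>. Both steps use only
\<open>\<bar>sgn p\<bar> \<le> 1\<close> and \<open>sgn p \<bullet> p = \<bar>p\<bar>\<close>, which include the case \<open>p = 0\<close>.\<close>

lemma drift_difference_bound:
  fixes b p q :: "'a::euclidean_space"
  assumes "norm b \<le> B"
  shows "b \<bullet> p + (B *\<^sub>R sgn p) \<bullet> q \<ge> - B * norm (p - q)"
proof -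
  have B: "B \<ge> 0" using assms norm_ge_zero order_trans by blast
  have "\<bar>b \<bullet> p\<bar> \<le> B * norm p"
    using Cauchy_Schwarz_ineq2[of b p] mult_right_mono[OF assms norm_ge_zero[of p]] by linarith
  moreover have "sgn p \<bullet> p = norm p"
    by (cases "p = 0") (simp_all add: sgn_div_norm power2_norm_eq_inner[symmetric] power2_eq_square)
  moreover have "sgn p \<bullet> (p - q) \<le> norm (p - q)"
  proof -
    have "sgn p \<bullet> (p - q) \<le> norm (sgn p) * norm (p - q)"
      by (rule norm_cauchy_schwarz)
    also have "\<dots> \<le> 1 * norm (p - q)"
      by (intro mult_right_mono) (auto simp: norm_sgn)
    finally show ?thesis by simp
  qed
  then have "B * (sgn p \<bullet> (p - q)) \<le> B * norm (p - q)"
    using B by (rule mult_left_mono)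
  ultimately show ?thesis
    by (simp add: inner_diff_right right_diff_distrib)
qed

theorem lemma1:
  fixes \<Omega> :: "'a::euclidean_space set" and b :: "'a \<Rightarrow> 'a" and w u :: "'a \<Rightarrow> real"
  assumes "open \<Omega>" and "bounded \<Omega>"
    and "b \<in> borel_measurable (lebesgue_on \<Omega>)" and "Linf_norm \<Omega> b < \<infinity>"
    and "strong_dirichlet_solution \<Omega> b (\<lambda>x. 1) w"
    and "strong_dirichlet_solution \<Omega>
           (\<lambda>x. - (enn2real (Linf_norm \<Omega> b) *\<^sub>R sgn (weak_gradient \<Omega> w x))) (\<lambda>x. 1) u"
  shows "\<forall>x\<in>\<Omega>. u x \<ge> w x"
proof
  fix x assume x: "x \<in> \<Omega>"
  note \<Omega> = assms(1,2)
  define B where "B = enn2real (Linf_norm \<Omega> b)"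
  have w: "W_loc 2 (real DIM('a)) \<Omega> w" "continuous_on (closure \<Omega>) w" "\<And>x. x \<in> frontier \<Omega> \<Longrightarrow> w x = 0"
      "AE x in lebesgue_on \<Omega>. - weak_laplacian \<Omega> w x + b x \<bullet> weak_gradient \<Omega> w x = 1"
    using assms(5) by (auto simp: strong_dirichlet_solution_def)
  have u: "W_loc 2 (real DIM('a)) \<Omega> u" "continuous_on (closure \<Omega>) u" "\<And>x. x \<in> frontier \<Omega> \<Longrightarrow> u x = 0"
      "AE x in lebesgue_on \<Omega>. - weak_laplacian \<Omega> u x
         + (- (B *\<^sub>R sgn (weak_gradient \<Omega> w x))) \<bullet> weak_gradient \<Omega> u x = 1"
    using assms(6) unfolding strong_dirichlet_solution_def B_def by blast+
  have bB: "AE x in lebesgue_on \<Omega>. norm (b x) \<le> B"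
  proof -
    have "AE x in lebesgue_on \<Omega>. ennreal (norm (b x)) \<le> Linf_norm \<Omega> b"
      unfolding Linf_norm_def by (rule esssup_AE)
    then show ?thesis
    proof eventually_elim
      case (elim x)
      then have "ennreal (norm (b x)) \<le> ennreal B"
        using assms(4) by (simp add: B_def)
      then show ?case by (simp add: B_def ennreal_le_iff)
    qed
  qed
  have pde: "AE x in lborel. x \<in> \<Omega> \<longrightarrow> weak_laplacian \<Omega> w x - weak_laplacian \<Omega> u x
      \<ge> - B * norm (weak_gradient \<Omega> w x - weak_gradient \<Omega> u x)"
    unfolding AE_lebesgue_on_iff_lborel[OF \<Omega>(1), symmetric]
    using w(4) u(4) bB
  proof eventually_elim
    case (elim x)
    then show ?case
      using drift_difference_bound[of "b x" B "weak_gradient \<Omega> w x" "weak_gradient \<Omega> u x"]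
      by (simp add: inner_minus_left)
  qed
  \<comment> \<open>Extending by \<open>0\<close> preserves continuity because both solutions vanish on the boundary.\<close>
  define Z where "Z x = (if x \<in> \<Omega> then w x - u x else 0)" for x
  have "Z x \<le> 0"
  proof (rule weak_maximum_principle[OF \<Omega>])
    show "B \<ge> 0" by (simp add: B_def)
    show "Z x = 0" if "x \<notin> \<Omega>" for x
      using that by (simp add: Z_def)
    have "continuous_on (closure \<Omega> \<union> - \<Omega>) (\<lambda>x. if x \<in> \<Omega> then w x - u x else 0)"
    proof (rule continuous_on_cases)
      show "continuous_on (closure \<Omega>) (\<lambda>x. w x - u x)"
        using w(2) u(2) by (rule continuous_on_diff)
      have "w x = 0 \<and> u x = 0" if "x \<in> closure \<Omega>" "x \<notin> \<Omega>" for x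
        using that w(3) u(3) \<Omega>(1) by (simp add: frontier_def interior_open)
      then show "\<forall>x. x \<in> closure \<Omega> \<and> x \<notin> \<Omega> \<or> x \<in> - \<Omega> \<and> x \<in> \<Omega> \<longrightarrow> w x - u x = 0"
        by auto
    qed (use \<Omega>(1) in auto)
    moreover have "closure \<Omega> \<union> - \<Omega> = UNIV"
      using closure_subset by blast
    ultimately show contZ: "continuous_on UNIV Z"
      by (simp add: Z_def[abs_def])
    fix K assume K: "compact K" "K \<subseteq> \<Omega>"
    obtain Fw Gw Hw where repw: "local_rep K w Fw"
        "\<And>i. i \<in> Basis \<Longrightarrow> local_rep K (weak_partial \<Omega> i w) (Gw i)"
        "\<And>i. i \<in> Basis \<Longrightarrow> local_rep K (weak_partial \<Omega> i (weak_partial \<Omega> i w)) (Hw i)"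
        "\<And>i. i \<in> Basis \<Longrightarrow> weak_partial_on K i Fw (Gw i)"
        "\<And>i. i \<in> Basis \<Longrightarrow> weak_partial_on K i (Gw i) (Hw i)"
      using W_loc_2_imp_weak_partial_on[OF w(1) \<Omega>(1) K] by blast
    obtain Fu Gu Hu where repu: "local_rep K u Fu"
        "\<And>i. i \<in> Basis \<Longrightarrow> local_rep K (weak_partial \<Omega> i u) (Gu i)"
        "\<And>i. i \<in> Basis \<Longrightarrow> local_rep K (weak_partial \<Omega> i (weak_partial \<Omega> i u)) (Hu i)"
        "\<And>i. i \<in> Basis \<Longrightarrow> weak_partial_on K i Fu (Gu i)"
        "\<And>i. i \<in> Basis \<Longrightarrow> weak_partial_on K i (Gu i) (Hu i)"
      using W_loc_2_imp_weak_partial_on[OF u(1) \<Omega>(1) K] by blast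
    have rF: "integrable lborel Fw" "integrable lborel Fu"
      and eF: "AE x in lborel. x \<in> K \<longrightarrow> Fw x = w x" "AE x in lborel. x \<in> K \<longrightarrow> Fu x = u x"
      using repw(1) repu(1) by (auto simp: local_rep_def)
    have rG: "integrable lborel (Gw i)" "integrable lborel (Gu i)"
      and rH: "integrable lborel (Hw i)" "integrable lborel (Hu i)" if "i \<in> Basis" for i
      using repw(2,3)[OF that] repu(2,3)[OF that] by (auto simp: local_rep_def)
    define G where "G i y = Gw i y - Gu i y" for i y
    define H where "H i y = Hw i y - Hu i y" for i y
    obtain R where R: "\<And>y. y \<in> \<Omega> \<Longrightarrow> norm y \<le> R"
      using \<Omega>(2) bounded_iff by blast
    have intZ: "integrable lborel Z"
      by (rule integrable_of_compact_support[OF contZ compact_cball[of 0 R]])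
        (use R in \<open>auto simp: Z_def\<close>)
    have ZF: "AE x in lborel. x \<in> K \<longrightarrow> Z x = Fw x - Fu x"
      using eF by eventually_elim (use K(2) in \<open>auto simp: Z_def\<close>)
    have "integrable lborel (G i) \<and> integrable lborel (H i)
        \<and> weak_partial_on K i Z (G i) \<and> weak_partial_on K i (G i) (H i)" if i: "i \<in> Basis" for i
    proof (intro conjI)
      show "integrable lborel (G i)" "integrable lborel (H i)"
        using rG[OF i] rH[OF i] by (simp_all add: G_def[abs_def] H_def[abs_def])
      have "weak_partial_on K i (\<lambda>x. Fw x - Fu x) (G i)"
        unfolding G_def[abs_def] by (rule weak_partial_on_diff[OF repw(4)[OF i] repu(4)[OF i] i rF rG[OF i]])
      then show "weak_partial_on K i Z (G i)"
        by (rule weak_partial_on_cong[OF _ i _ intZ ZF]) (use rF in simp)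
      show "weak_partial_on K i (G i) (H i)"
        unfolding G_def[abs_def] H_def[abs_def]
        by (rule weak_partial_on_diff[OF repw(5)[OF i] repu(5)[OF i] i rG[OF i] rH[OF i]])
    qed
    moreover have "AE y in lborel. y \<in> K \<longrightarrow> (\<Sum>i\<in>Basis. H i y) \<ge> - B * norm (field_of G y)"
    proof -
      have "AE y in lborel. \<forall>i\<in>Basis. y \<in> K \<longrightarrow> G i y = weak_partial \<Omega> i w y - weak_partial \<Omega> i u y
          \<and> H i y = weak_partial \<Omega> i (weak_partial \<Omega> i w) y - weak_partial \<Omega> i (weak_partial \<Omega> i u) y"
      proof (rule AE_ball_countable[THEN iffD2])
        show "countable (Basis :: 'a set)" by (simp add: countable_finite)
        show "\<forall>i\<in>Basis. AE y in lborel. y \<in> K \<longrightarrow> G i y = weak_partial \<Omega> i w y - weak_partial \<Omega> i u y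
          \<and> H i y = weak_partial \<Omega> i (weak_partial \<Omega> i w) y - weak_partial \<Omega> i (weak_partial \<Omega> i u) y"
        proof
          fix i :: 'a assume i: "i \<in> Basis"
          show "AE y in lborel. y \<in> K \<longrightarrow> G i y = weak_partial \<Omega> i w y - weak_partial \<Omega> i u y
            \<and> H i y = weak_partial \<Omega> i (weak_partial \<Omega> i w) y - weak_partial \<Omega> i (weak_partial \<Omega> i u) y"
            using repw(2,3)[OF i, unfolded local_rep_def, THEN conjunct2]
              repu(2,3)[OF i, unfolded local_rep_def, THEN conjunct2]
            by eventually_elim (auto simp: G_def H_def)
        qed
      qed
      with pde show ?thesis
      proof eventually_elim
        case (elim y)
        show ?case
        proof
          assume y: "y \<in> K"
          have "field_of G y = weak_gradient \<Omega> w y - weak_gradient \<Omega> u y"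
            using elim(2) y by (simp add: field_of_def weak_gradient_def sum_subtractf scaleR_left_diff_distrib)
          moreover have "(\<Sum>i\<in>Basis. H i y) = weak_laplacian \<Omega> w y - weak_laplacian \<Omega> u y"
            using elim(2) y by (simp add: weak_laplacian_def sum_subtractf)
          ultimately show "(\<Sum>i\<in>Basis. H i y) \<ge> - B * norm (field_of G y)"
            using elim(1) y K(2) by auto
        qed
      qed
    qed
    ultimately show "\<exists>G H. (\<forall>i\<in>Basis. integrable lborel (G i) \<and> integrable lborel (H i)
        \<and> weak_partial_on K i Z (G i) \<and> weak_partial_on K i (G i) (H i))
      \<and> (AE y in lborel. y \<in> K \<longrightarrow> (\<Sum>i\<in>Basis. H i y) \<ge> - B * norm (field_of G y))"
      by blast
  qed
  then show "w x \<le> u x"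
    using x by (simp add: Z_def)
qed

end
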